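(* Let $J_\sigma,J_\tau,J_{\sigma\tau}\in\mathbb{R}$ and let $$a_0=e^{-2(J_\sigma+J_\tau)},\quad a_\sigma=e^{-2J_\tau}(e^{-2J_{\sigma\tau}}-e^{-2J_\sigma}),\quad a_\tau=e^{-2J_\sigma}(e^{-2J_{\sigma\tau}}-e^{-2J_\tau}),$$ $$a_{\sigma\tau}=1-e^{-2(J_\sigma+J_{\sigma\tau})}-e^{-2(J_\tau+J_{\sigma\tau})}+e^{-2(J_\sigma+J_\tau)}.$$ The constants $a_0,a_\sigma,a_\tau,a_{\sigma\tau}$ define a probability measure on $\{0,1\}\times\{0,1\}$ (assigning mass $a_0$ to $(0,0)$, $a_\sigma$ to $(1,0)$, $a_\tau$ to $(0,1)$, $a_{\sigma\tau}$ to $(1,1)$) if and only if $$J_\sigma\ge J_{\sigma\tau},\quad J_\tau\ge J_{\sigma\tau},\quad J_\sigma\ge0,\quad J_\tau\ge 0,\quad \tanh J_{\sigma\tau}\ge-\tanh J_\sigma\tanh J_\tau .$$ Moreover, with this choice of probabilities (at every bond), for $\Lambda\subset\mathbb{Z}^2$ bounded and simply connected: 1. There are constants $C_2,C_3$, independent of the configuration, such that $$\mathcal{Z}^{++}_\Lambda=C_2\sum_{\underline n:\,(+,+)\text{-b.c. on }\Lambda}\lambda_{\mathcal{B}^+(\Lambda)}(\underline n)\,2^{N_\sigma(\underline n|\Lambda)}2^{N_\tau(\underline n|\Lambda)},\qquad \mathcal{Z}^{f}_\Lambda=C_3\sum_{\underline n:\,\text{free b.c. on }\Lambda}\lambda_{\mathcal{B}(\Lambda)}(\underline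 n)\,2^{N_\sigma(\underline n|\Lambda)}2^{N_\tau(\underline n|\Lambda)} .$$ 2. For sets of sites $A,B\subset\Lambda$, $$\mu^{++}_\Lambda(\sigma_A\tau_B)=\nu^+_\Lambda(\kappa^\sigma_A\kappa^\tau_B\,|\,2,2),\qquad \mu^{f}_\Lambda(\sigma_A\tau_B)=\nu^f_\Lambda(\kappa^\sigma_A\kappa^\tau_B\,|\,2,2),$$ where $\sigma_A=\prod_{i\in A}\sigma_i$, $\tau_B=\prod_{i\in B}\tau_i$.
   Context: **Lattice.** Bonds $b=\langle i,j\rangle$ are pairs of nearest neighbours of $\mathbb{Z}^2$. $\Lambda\subset\mathbb{Z}^2$ is simply connected if the union of the closed unit squares centred at the points of $\Lambda$ is a simply connected subset of $\mathbb{R}^2$. $\mathcal{B}(\Lambda)$ is the set of bonds with both endpoints in $\Lambda$; $\mathcal{B}^+(\Lambda)$ the set of bonds with at least one endpoint in $\Lambda$. **Ashkin–Teller model.** Spins $(\sigma_i,\tau_i)\in\{-1,1\}^2$; bond weight $w_{ij}=\exp(J_\sigma\sigma_i\sigma_j+J_\tau\tau_i\tau_j+J_{\sigma\tau}\sigma_i\sigma_j\tau_i\tau_j)$. - $(+,+)$-boundary condition: $\mu^{++}_\Lambda$ is the probability measure on configurations equal to $(1,1)$ at every site outside $\Lambda$, with weight $\prod_{\langle i,j\rangle\in\mathcal{B}^+(\Lambda)}w_{ij}$ divided by the total weight $\Xi^{(+,+)}_\Lambda$. Normalized partition function: $\mathcal{Z}^{++}_\Lambda=e^{-(J_\sigma+J_\tau+J_{\sigma\tau})|\mathcal{B}^+(\Lambda)|}\,\Xi^{(+,+)}_\Lambda$.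 - Free boundary condition: $\mu^f_\Lambda$ is the probability measure on spin configurations in $\Lambda$ with weight $\prod_{\langle i,j\rangle\in\mathcal{B}(\Lambda)}w_{ij}$ divided by the total weight $\Xi^f_\Lambda$. Normalized partition function: $\mathcal{Z}^f_\Lambda=\Xi^f_\Lambda\,4^{-|\Lambda|}\big[(1+stl)\cosh J_\sigma\cosh J_\tau\cosh J_{\sigma\tau}\big]^{-|\mathcal{B}(\Lambda)|}$ with $s=\tanh J_\sigma$, $t=\tanh J_\tau$, $l=\tanh J_{\sigma\tau}$. **Generalized random-cluster (GRC) model.** A configuration $\underline n=(\underline n_\sigma,\underline n_\tau)$ assigns to every bond $b$ of $\mathbb{Z}^2$ a value $n_b=(n_{\sigma,b},n_{\tau,b})\in\{0,1\}^2$; $b$ is $\sigma$-open if $n_{\sigma,b}=1$. The $\sigma$-clusters are the connected components (isolated sites included) of the graph on $\mathbb{Z}^2$ whose edges are the $\sigma$-open bonds; similarly for $\tau$. $N_\sigma(\underline n|\Lambda)$ (resp. $N_\tau(\underline n|\Lambda)$) is the number of $\sigma$-clusters (resp. $\tau$-clusters) of $\underline n$ which intersect $\Lambda$. For a finite set of bonds $\mathcal{B}$, $$\lambda_{\mathcal{B}}(\underline n)=\prod_{b\in\mathcal{B}:n_b=(0,0)}a_0\prod_{b\in\mathcal{B}:n_b=(1,0)}a_\sigma\prod_{b\in\mathcal{B}:n_b=(0,1)}a_\tau\prod_{b\in\mathcal{B}:n_b=(1,1)}a_{\sigma\tau}.$$ $\underline n$ satisfies the $(+,+)$-b.c. on $\Lambda$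 if $n_b=(1,1)$ for all $b\notin\mathcal{B}^+(\Lambda)$, and the free b.c. on $\Lambda$ if $n_b=(0,0)$ for all $b\notin\mathcal{B}(\Lambda)$. For $q_\sigma,q_\tau>0$, $\nu^+_\Lambda(\cdot|q_\sigma,q_\tau)$ (resp. $\nu^f_\Lambda(\cdot|q_\sigma,q_\tau)$) is the probability measure on configurations satisfying the $(+,+)$-b.c. (resp. free b.c.) on $\Lambda$ with probabilities proportional to $\lambda_{\mathcal{B}}(\underline n)\,q_\sigma^{N_\sigma(\underline n|\Lambda)}q_\tau^{N_\tau(\underline n|\Lambda)}$, where $\mathcal{B}=\mathcal{B}^+(\Lambda)$ (resp. $\mathcal{B}=\mathcal{B}(\Lambda)$). **Indicator functions.** $\kappa^\sigma_A(\underline n)=1$ if no finite $\sigma$-cluster of $\underline n$ contains an odd number of sites of $A$, and $0$ otherwise; $\kappa^\tau_B$ is defined likewise with $\tau$-clusters and $B$.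
   Formalization: N_σ and N_τ count only the finite clusters intersecting Λ; if the infinite cluster is counted exactly when it meets Λ, item 2 for the (+,+)-b.c. fails already for Λ={0}, A={0}, B=∅, J_τ=J_στ=0, J_σ>0. Nothing changes for the free b.c. *)

theory Defs
  imports "HOL-Probability.Probability"
begin

section \<open>The lattice\<close>

type_synonym site = "int \<times> int"

definition nearest_neighbours :: "site \<Rightarrow> site \<Rightarrow> bool" where
  "nearest_neighbours i j \<longleftrightarrow> \<bar>fst i - fst j\<bar> + \<bar>snd i - snd j\<bar> = 1"

typedef bond = "{{i, j} | i j. nearest_neighbours i j}"
  morphisms endpoints Bond
proof -
  have "nearest_neighbours (0, 0) (1, 0)"
    by (simp add: nearest_neighbours_def)
  then show ?thesis
    by blast
qed

definition bonds_inside :: "site set \<Rightarrow> bond set" where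
  "bonds_inside \<Lambda> = {b. endpoints b \<subseteq> \<Lambda>}"

definition bonds_touching :: "site set \<Rightarrow> bond set" where
  "bonds_touching \<Lambda> = {b. endpoints b \<inter> \<Lambda> \<noteq> {}}"

definition unit_square :: "site \<Rightarrow> (real \<times> real) set" where
  "unit_square i = {real_of_int (fst i) - 1/2 .. real_of_int (fst i) + 1/2} \<times>
                   {real_of_int (snd i) - 1/2 .. real_of_int (snd i) + 1/2}"

definition lattice_bounded :: "site set \<Rightarrow> bool" where
  "lattice_bounded \<Lambda> \<longleftrightarrow> bounded ((\<lambda>(x, y). (real_of_int x, real_of_int y)) ` \<Lambda>)"

definition lattice_simply_connected :: "site set \<Rightarrow> bool" where
  "lattice_simply_connected \<Lambda> \<longleftrightarrow> simply_connected (\<Union>i\<in>\<Lambda>. unit_square i)"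


section \<open>Finite probability measures given by weights\<close>

definition weighted_pmf :: "'a set \<Rightarrow> ('a \<Rightarrow> real) \<Rightarrow> 'a pmf" where
  "weighted_pmf S w = embed_pmf (\<lambda>x. if x \<in> S then w x / (\<Sum>y\<in>S. w y) else 0)"

lemma pmf_weighted_pmf:
  assumes fin: "finite S" and nonneg: "\<And>x. x \<in> S \<Longrightarrow> 0 \<le> w x" and pos: "0 < (\<Sum>y\<in>S. w y)"
  shows "pmf (weighted_pmf S w) x = (if x \<in> S then w x / (\<Sum>y\<in>S. w y) else 0)"
proof -
  let ?f = "\<lambda>x. if x \<in> S then w x / (\<Sum>y\<in>S. w y) else 0"
  have nn: "0 \<le> ?f x" for x
    using nonneg pos by auto
  have "(\<integral>\<^sup>+ x. ennreal (?f x) \<partial>count_space UNIV) = (\<Sum>x\<in>S. ennreal (?f x))"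
    using fin by (intro nn_integral_count_space') auto
  also have "\<dots> = ennreal (\<Sum>x\<in>S. ?f x)"
    by (rule sum_ennreal) (rule nn)
  also have "(\<Sum>x\<in>S. ?f x) = 1"
    using pos by (simp flip: sum_divide_distrib)
  finally show ?thesis
    unfolding weighted_pmf_def using nn by (subst pmf_embed_pmf) auto
qed


section \<open>The Ashkin--Teller model\<close>

text \<open>A spin configuration is the pair of its \<open>\<sigma>\<close>- and \<open>\<tau>\<close>-component.\<close>

type_synonym spins = "(site \<Rightarrow> real) \<times> (site \<Rightarrow> real)"

definition spin_prod :: "(site \<Rightarrow> real) \<Rightarrow> site set \<Rightarrow> real" where
  "spin_prod s A = (\<Prod>i\<in>A. s i)"

definition AT_weight :: "real \<Rightarrow> real \<Rightarrow> real \<Rightarrow> bond set \<Rightarrow> spins \<Rightarrow> real" where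
  "AT_weight J\<^sub>\<sigma> J\<^sub>\<tau> J\<^sub>\<sigma>\<^sub>\<tau> \<B> = (\<lambda>(\<sigma>, \<tau>). \<Prod>b\<in>\<B>.
     exp (J\<^sub>\<sigma> * spin_prod \<sigma> (endpoints b) + J\<^sub>\<tau> * spin_prod \<tau> (endpoints b)
          + J\<^sub>\<sigma>\<^sub>\<tau> * spin_prod \<sigma> (endpoints b) * spin_prod \<tau> (endpoints b)))"

definition plus_spins :: "site set \<Rightarrow> spins set" where
  "plus_spins \<Lambda> = {(\<sigma>, \<tau>). (\<forall>i. \<sigma> i \<in> {-1, 1} \<and> \<tau> i \<in> {-1, 1}) \<and>
                            (\<forall>i. i \<notin> \<Lambda> \<longrightarrow> \<sigma> i = 1 \<and> \<tau> i = 1)}"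

definition free_spins :: "site set \<Rightarrow> spins set" where
  "free_spins \<Lambda> = (\<Lambda> \<rightarrow>\<^sub>E {-1, 1}) \<times> (\<Lambda> \<rightarrow>\<^sub>E {-1, 1})"

definition Xi_plus :: "real \<Rightarrow> real \<Rightarrow> real \<Rightarrow> site set \<Rightarrow> real" where
  "Xi_plus J\<^sub>\<sigma> J\<^sub>\<tau> J\<^sub>\<sigma>\<^sub>\<tau> \<Lambda> =
     (\<Sum>\<omega>\<in>plus_spins \<Lambda>. AT_weight J\<^sub>\<sigma> J\<^sub>\<tau> J\<^sub>\<sigma>\<^sub>\<tau> (bonds_touching \<Lambda>) \<omega>)"

definition Xi_free :: "real \<Rightarrow> real \<Rightarrow> real \<Rightarrow> site set \<Rightarrow> real" where
  "Xi_free J\<^sub>\<sigma> J\<^sub>\<tau> J\<^sub>\<sigma>\<^sub>\<tau> \<Lambda> =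
     (\<Sum>\<omega>\<in>free_spins \<Lambda>. AT_weight J\<^sub>\<sigma> J\<^sub>\<tau> J\<^sub>\<sigma>\<^sub>\<tau> (bonds_inside \<Lambda>) \<omega>)"

definition mu_plus :: "real \<Rightarrow> real \<Rightarrow> real \<Rightarrow> site set \<Rightarrow> spins pmf" where
  "mu_plus J\<^sub>\<sigma> J\<^sub>\<tau> J\<^sub>\<sigma>\<^sub>\<tau> \<Lambda> =
     weighted_pmf (plus_spins \<Lambda>) (AT_weight J\<^sub>\<sigma> J\<^sub>\<tau> J\<^sub>\<sigma>\<^sub>\<tau> (bonds_touching \<Lambda>))"

definition mu_free :: "real \<Rightarrow> real \<Rightarrow> real \<Rightarrow> site set \<Rightarrow> spins pmf" where
  "mu_free J\<^sub>\<sigma> J\<^sub>\<tau> J\<^sub>\<sigma>\<^sub>\<tau> \<Lambda> =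
     weighted_pmf (free_spins \<Lambda>) (AT_weight J\<^sub>\<sigma> J\<^sub>\<tau> J\<^sub>\<sigma>\<^sub>\<tau> (bonds_inside \<Lambda>))"

definition Z_plus :: "real \<Rightarrow> real \<Rightarrow> real \<Rightarrow> site set \<Rightarrow> real" where
  "Z_plus J\<^sub>\<sigma> J\<^sub>\<tau> J\<^sub>\<sigma>\<^sub>\<tau> \<Lambda> =
     exp (- (J\<^sub>\<sigma> + J\<^sub>\<tau> + J\<^sub>\<sigma>\<^sub>\<tau>) * real (card (bonds_touching \<Lambda>))) * Xi_plus J\<^sub>\<sigma> J\<^sub>\<tau> J\<^sub>\<sigma>\<^sub>\<tau> \<Lambda>"

definition Z_free :: "real \<Rightarrow> real \<Rightarrow> real \<Rightarrow> site set \<Rightarrow> real" where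
  "Z_free J\<^sub>\<sigma> J\<^sub>\<tau> J\<^sub>\<sigma>\<^sub>\<tau> \<Lambda> =
     Xi_free J\<^sub>\<sigma> J\<^sub>\<tau> J\<^sub>\<sigma>\<^sub>\<tau> \<Lambda> / (4 ^ card \<Lambda> *
       ((1 + tanh J\<^sub>\<sigma> * tanh J\<^sub>\<tau> * tanh J\<^sub>\<sigma>\<^sub>\<tau>) * cosh J\<^sub>\<sigma> * cosh J\<^sub>\<tau> * cosh J\<^sub>\<sigma>\<^sub>\<tau>) ^ card (bonds_inside \<Lambda>))"


section \<open>The generalized random-cluster model\<close>

text \<open>The values 1 and 0 of \<open>n\<^sub>\<sigma>\<close> and \<open>n\<^sub>\<tau>\<close> are encoded by \<open>True\<close> (open) and \<open>False\<close> (closed),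
  so that the sets of \<open>\<sigma>\<close>- and \<open>\<tau>\<close>-open bonds of \<open>n\<close> are given by \<open>fst \<circ> n\<close> and \<open>snd \<circ> n\<close>.\<close>

type_synonym grc_config = "bond \<Rightarrow> bool \<times> bool"

definition clusters :: "(bond \<Rightarrow> bool) \<Rightarrow> site set set" where
  "clusters opn = UNIV // {(i, j). \<exists>b. opn b \<and> endpoints b = {i, j}}\<^sup>*"

text \<open>Only the finite clusters that intersect \<open>\<Lambda>\<close> are counted. Under the free boundary condition
  every cluster is finite (lemma \<open>finite_cluster_free_bc\<close>), so this is the number of all clusters
  intersecting \<open>\<Lambda>\<close>. Under the \<open>(+,+)\<close> boundary condition the infinite cluster has to be treated in
  the same way in all configurations, whether or not it enters \<open>\<Lambda>\<close>: the sites of \<open>\<Lambda>\<close> which are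
  connected to the exterior have their spin fixed by the boundary condition, whereas every finite
  cluster carries a free spin. If the infinite cluster were counted exactly when it intersects
  \<open>\<Lambda>\<close>, the random-cluster representation would already fail for \<open>\<Lambda> = {(0, 0)}\<close>.\<close>

definition num_clusters :: "(bond \<Rightarrow> bool) \<Rightarrow> site set \<Rightarrow> nat" where
  "num_clusters opn \<Lambda> = card {C \<in> clusters opn. finite C \<and> C \<inter> \<Lambda> \<noteq> {}}"

definition grc_weight :: "real \<Rightarrow> real \<Rightarrow> real \<Rightarrow> real \<Rightarrow> bond set \<Rightarrow> grc_config \<Rightarrow> real" where
  "grc_weight a\<^sub>0 a\<^sub>\<sigma> a\<^sub>\<tau> a\<^sub>\<sigma>\<^sub>\<tau> \<B> n =
     (\<Prod>b\<in>{b\<in>\<B>. n b = (False, False)}. a\<^sub>0) * (\<Prod>b\<in>{b\<in>\<B>. n b = (True, False)}. a\<^sub>\<sigma>) *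
     (\<Prod>b\<in>{b\<in>\<B>. n b = (False, True)}. a\<^sub>\<tau>) * (\<Prod>b\<in>{b\<in>\<B>. n b = (True, True)}. a\<^sub>\<sigma>\<^sub>\<tau>)"

definition plus_bc :: "site set \<Rightarrow> grc_config set" where
  "plus_bc \<Lambda> = {n. \<forall>b. b \<notin> bonds_touching \<Lambda> \<longrightarrow> n b = (True, True)}"

definition free_bc :: "site set \<Rightarrow> grc_config set" where
  "free_bc \<Lambda> = {n. \<forall>b. b \<notin> bonds_inside \<Lambda> \<longrightarrow> n b = (False, False)}"

definition cluster_weight :: "real \<Rightarrow> real \<Rightarrow> site set \<Rightarrow> grc_config \<Rightarrow> real" where
  "cluster_weight q\<^sub>\<sigma> q\<^sub>\<tau> \<Lambda> n =
     q\<^sub>\<sigma> ^ num_clusters (fst \<circ> n) \<Lambda> * q\<^sub>\<tau> ^ num_clusters (snd \<circ> n) \<Lambda>"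

definition nu_plus ::
  "real \<Rightarrow> real \<Rightarrow> real \<Rightarrow> real \<Rightarrow> site set \<Rightarrow> real \<Rightarrow> real \<Rightarrow> grc_config pmf" where
  "nu_plus a\<^sub>0 a\<^sub>\<sigma> a\<^sub>\<tau> a\<^sub>\<sigma>\<^sub>\<tau> \<Lambda> q\<^sub>\<sigma> q\<^sub>\<tau> = weighted_pmf (plus_bc \<Lambda>)
     (\<lambda>n. grc_weight a\<^sub>0 a\<^sub>\<sigma> a\<^sub>\<tau> a\<^sub>\<sigma>\<^sub>\<tau> (bonds_touching \<Lambda>) n * cluster_weight q\<^sub>\<sigma> q\<^sub>\<tau> \<Lambda> n)"

definition nu_free ::
  "real \<Rightarrow> real \<Rightarrow> real \<Rightarrow> real \<Rightarrow> site set \<Rightarrow> real \<Rightarrow> real \<Rightarrow> grc_config pmf" where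
  "nu_free a\<^sub>0 a\<^sub>\<sigma> a\<^sub>\<tau> a\<^sub>\<sigma>\<^sub>\<tau> \<Lambda> q\<^sub>\<sigma> q\<^sub>\<tau> = weighted_pmf (free_bc \<Lambda>)
     (\<lambda>n. grc_weight a\<^sub>0 a\<^sub>\<sigma> a\<^sub>\<tau> a\<^sub>\<sigma>\<^sub>\<tau> (bonds_inside \<Lambda>) n * cluster_weight q\<^sub>\<sigma> q\<^sub>\<tau> \<Lambda> n)"

definition kappa :: "site set \<Rightarrow> (bond \<Rightarrow> bool) \<Rightarrow> real" where
  "kappa A opn = (if \<exists>C\<in>clusters opn. finite C \<and> odd (card (C \<inter> A)) then 0 else 1)"

definition defines_prob_measure :: "real \<Rightarrow> real \<Rightarrow> real \<Rightarrow> real \<Rightarrow> bool" where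
  "defines_prob_measure a\<^sub>0 a\<^sub>\<sigma> a\<^sub>\<tau> a\<^sub>\<sigma>\<^sub>\<tau> \<longleftrightarrow> (\<exists>p :: (bool \<times> bool) pmf.
     pmf p (False, False) = a\<^sub>0 \<and> pmf p (True, False) = a\<^sub>\<sigma> \<and>
     pmf p (False, True) = a\<^sub>\<tau> \<and> pmf p (True, True) = a\<^sub>\<sigma>\<^sub>\<tau>)"

lemma finite_cluster_free_bc:
  assumes "finite \<Lambda>" "n \<in> free_bc \<Lambda>" "C \<in> clusters (fst \<circ> n) \<or> C \<in> clusters (snd \<circ> n)"
  shows "finite C"
proof -
  have *: "finite C" if opn: "\<And>b. opn b \<Longrightarrow> endpoints b \<subseteq> \<Lambda>" and C: "C \<in> clusters opn" for opn
  proof -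
    obtain i where i: "C = {(i, j). \<exists>b. opn b \<and> endpoints b = {i, j}}\<^sup>* `` {i}"
      using C by (auto simp: clusters_def elim!: quotientE)
    have "j \<in> insert i \<Lambda>" if "(i, j) \<in> {(i, j). \<exists>b. opn b \<and> endpoints b = {i, j}}\<^sup>*" for j
      using that by (induction rule: rtrancl_induct) (use opn in fastforce)+
    then have "C \<subseteq> insert i \<Lambda>"
      unfolding i by blast
    then show ?thesis
      using assms(1) by (meson finite_insert finite_subset)
  qed
  have "endpoints b \<subseteq> \<Lambda>" if "(fst \<circ> n) b \<or> (snd \<circ> n) b" for b
    using assms(2) that by (force simp: free_bc_def bonds_inside_def)
  then show ?thesis
    using assms(3) *[of "fst \<circ> n"] *[of "snd \<circ> n"] by blast
qed

end

theory Submission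
  imports Defs
begin

text \<open>Up to the factor \<open>exp (J\<^sub>\<sigma> + J\<^sub>\<tau> + J\<^sub>\<sigma>\<^sub>\<tau>)\<close>, the weight of a bond is the sum of \<open>a\<^sub>n\<close> over those
  values \<open>n\<close> for which the spins agree across the bond in each component that is open (the
  Edwards--Sokal coupling). Expand the product over the bonds and sum over the spins first: given the
  open bonds, the spins are constant on clusters, fixed to 1 on the infinite one and free on the finite
  ones, which gives a factor 2 per finite cluster and kills the clusters containing an odd number of
  sites of \<open>A\<close>. For the plus boundary condition one needs that a finite cluster meeting \<open>\<Lambda>\<close> lies
  inside \<open>\<Lambda>\<close>, i.e. that \<open>\<Lambda>\<close> has no holes. This is where simple connectedness enters: a finite union
  of closed squares is locally path connected, hence Borsukian if it is simply connected, hence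
  it does not separate the plane.\<close>

section \<open>The parameter region\<close>

text \<open>Replacing \<open>z\<close> by the smaller \<open>x\<close> in the last assumption leaves
  \<open>x * x \<le> 1\<close>. For \<open>x\<close>, \<open>y\<close>, \<open>z\<close> the
  exponentials of the couplings times -2, this recovers \<open>J\<^sub>\<sigma> \<ge> 0\<close> and,
  by symmetry, \<open>J\<^sub>\<tau> \<ge> 0\<close> from the signs of the masses.\<close>

lemma le_one_of_product_bound:
  fixes x y z :: real
  assumes "0 < x" "0 < y" "x \<le> z" "z * (x + y) \<le> 1 + x * y"
  shows "x \<le> 1"
proof -
  have "x * (x + y) \<le> z * (x + y)" using assms by (intro mult_right_mono) auto
  then have "x * x \<le> 1" using assms(4) by (simp add: algebra_simps)
  then show ?thesis
    by (metis assms(1) less_1_mult linorder_not_less)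
qed

text \<open>Writing \<open>tanh u\<close> as \<open>(1 - exp (-2*u)) / (1 + exp (-2*u))\<close> and
  clearing positive denominators leaves twice \<open>1 + x * y - z * (x + y)\<close>, which is
  \<open>a\<^sub>\<sigma>\<^sub>\<tau>\<close> in these variables.\<close>

lemma tanh_condition_iff:
  fixes J K L :: real
  defines "x \<equiv> exp (-2*J)" and "y \<equiv> exp (-2*K)" and "z \<equiv> exp (-2*L)"
  shows "- tanh J * tanh K \<le> tanh L \<longleftrightarrow> z * (x + y) \<le> 1 + x * y"
proof -
  have p: "0 < x" "0 < y" "0 < z" by (simp_all add: x_def y_def z_def)
  have "tanh L + tanh J * tanh K =
      2 * (1 + x * y - z * (x + y)) / ((1 + x) * (1 + y) * (1 + z))"
    using p unfolding tanh_real_altdef x_def[symmetric] y_def[symmetric] z_def[symmetric]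
    by (simp add: divide_simps) (simp add: algebra_simps)
  moreover have "0 < (1 + x) * (1 + y) * (1 + z)" using p by simp
  ultimately have "0 \<le> tanh L + tanh J * tanh K \<longleftrightarrow> 0 \<le> 1 + x * y - z * (x + y)"
    by (simp add: zero_le_divide_iff del: distrib_left right_diff_distrib_numeral distrib_left_numeral)
  then show ?thesis by auto
qed

lemma defines_prob_measure_iff:
  "defines_prob_measure a b c d \<longleftrightarrow> 0 \<le> a \<and> 0 \<le> b \<and> 0 \<le> c \<and> 0 \<le> d \<and> a + b + c + d = 1"
proof
  assume "defines_prob_measure a b c d"
  then obtain p :: "(bool \<times> bool) pmf" where p: "pmf p (False, False) = a" "pmf p (True, False) = b"
     "pmf p (False, True) = c" "pmf p (True, True) = d"
    by (auto simp: defines_prob_measure_def)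
  have "(\<Sum>x\<in>UNIV. pmf p x) = 1"
    by (intro sum_pmf_eq_1) auto
  then have "a + b + c + d = 1"
    using p by (simp add: UNIV_Times_UNIV[symmetric] UNIV_bool Sigma_def del: UNIV_Times_UNIV)
  then show "0 \<le> a \<and> 0 \<le> b \<and> 0 \<le> c \<and> 0 \<le> d \<and> a + b + c + d = 1"
    using p pmf_nonneg by metis
next
  assume *: "0 \<le> a \<and> 0 \<le> b \<and> 0 \<le> c \<and> 0 \<le> d \<and> a + b + c + d = 1"
  define w where "w = (\<lambda>n::bool \<times> bool. if fst n then (if snd n then d else b) else (if snd n then c else a))"
  have s: "(\<Sum>x\<in>UNIV. w x) = 1"
    using * by (simp add: w_def UNIV_Times_UNIV[symmetric] UNIV_bool Sigma_def del: UNIV_Times_UNIV)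
  \<comment> \<open>The total weight is already 1, so normalising changes nothing.\<close>
  have "pmf (weighted_pmf UNIV w) x = w x" for x
    using * s by (subst pmf_weighted_pmf) (auto simp: w_def)
  then show "defines_prob_measure a b c d"
    unfolding defines_prob_measure_def by (intro exI[of _ "weighted_pmf UNIV w"]) (simp add: w_def)
qed

lemma parameter_region:
  fixes J\<^sub>\<sigma> J\<^sub>\<tau> J\<^sub>\<sigma>\<^sub>\<tau> a\<^sub>0 a\<^sub>\<sigma> a\<^sub>\<tau> a\<^sub>\<sigma>\<^sub>\<tau> :: real
  assumes "a\<^sub>0 = exp (-2 * (J\<^sub>\<sigma> + J\<^sub>\<tau>))"
    and "a\<^sub>\<sigma> = exp (-2 * J\<^sub>\<tau>) * (exp (-2 * J\<^sub>\<sigma>\<^sub>\<tau>) - exp (-2 * J\<^sub>\<sigma>))"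
    and "a\<^sub>\<tau> = exp (-2 * J\<^sub>\<sigma>) * (exp (-2 * J\<^sub>\<sigma>\<^sub>\<tau>) - exp (-2 * J\<^sub>\<tau>))"
    and "a\<^sub>\<sigma>\<^sub>\<tau> = 1 - exp (-2 * (J\<^sub>\<sigma> + J\<^sub>\<sigma>\<^sub>\<tau>)) - exp (-2 * (J\<^sub>\<tau> + J\<^sub>\<sigma>\<^sub>\<tau>)) + exp (-2 * (J\<^sub>\<sigma> + J\<^sub>\<tau>))"
  shows "defines_prob_measure a\<^sub>0 a\<^sub>\<sigma> a\<^sub>\<tau> a\<^sub>\<sigma>\<^sub>\<tau> \<longleftrightarrow>
            J\<^sub>\<sigma> \<ge> J\<^sub>\<sigma>\<^sub>\<tau> \<and> J\<^sub>\<tau> \<ge> J\<^sub>\<sigma>\<^sub>\<tau> \<and> J\<^sub>\<sigma> \<ge> 0 \<and> J\<^sub>\<tau> \<ge> 0 \<and> tanh J\<^sub>\<sigma>\<^sub>\<tau> \<ge> - tanh J\<^sub>\<sigma> * tanh J\<^sub>\<tau>"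
proof -
  define x y z where "x = exp (-2*J\<^sub>\<sigma>)" and "y = exp (-2*J\<^sub>\<tau>)" and "z = exp (-2*J\<^sub>\<sigma>\<^sub>\<tau>)"
  note xyz = x_def[symmetric] y_def[symmetric] z_def[symmetric]
  have p: "0 < x" "0 < y" "0 < z" by (simp_all add: x_def y_def z_def)
  have a: "a\<^sub>0 = x * y" "a\<^sub>\<sigma> = y * (z - x)" "a\<^sub>\<tau> = x * (z - y)" "a\<^sub>\<sigma>\<^sub>\<tau> = 1 + x * y - z * (x + y)"
    by (simp_all add: assms x_def y_def z_def algebra_simps flip: exp_add)
  have J: "J\<^sub>\<sigma> \<ge> J\<^sub>\<sigma>\<^sub>\<tau> \<longleftrightarrow> x \<le> z" "J\<^sub>\<tau> \<ge> J\<^sub>\<sigma>\<^sub>\<tau> \<longleftrightarrow> y \<le> z" "J\<^sub>\<sigma> \<ge> 0 \<longleftrightarrow> x \<le> 1" "J\<^sub>\<tau> \<ge> 0 \<longleftrightarrow> y \<le> 1"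
    by (simp_all add: x_def y_def z_def)
  \<comment> \<open>The masses add up to 1 for all couplings, so only their signs matter.\<close>
  have "a\<^sub>0 + a\<^sub>\<sigma> + a\<^sub>\<tau> + a\<^sub>\<sigma>\<^sub>\<tau> = 1" by (simp add: a algebra_simps)
  moreover have "0 \<le> a\<^sub>\<sigma> \<longleftrightarrow> x \<le> z" "0 \<le> a\<^sub>\<tau> \<longleftrightarrow> y \<le> z" "0 \<le> a\<^sub>0"
    using p by (simp_all add: a zero_le_mult_iff)
  moreover have "0 \<le> a\<^sub>\<sigma>\<^sub>\<tau> \<longleftrightarrow> z * (x + y) \<le> 1 + x * y" by (simp add: a)
  ultimately show ?thesis
    unfolding defines_prob_measure_iff tanh_condition_iff J xyz
    using le_one_of_product_bound[of x y z] le_one_of_product_bound[of y x z] p by (auto simp: add.commute mult.commute)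
qed

section \<open>Simply connected sets of sites have no holes\<close>

text \<open>An ANR is locally path connected, so simple connectedness makes \<open>S\<close>
  Borsukian. This property passes through the homeomorphism \<open>h\<close> to the complex plane,
  where a compact Borsukian set has connected complement; \<open>k\<close> carries the complement
  back.\<close>

lemma simply_connected_compact_complement:
  fixes S :: "(real \<times> real) set"
  assumes "compact S" "simply_connected S" "ANR S"
  shows "connected (- S)"
proof -
  define h where "h = (\<lambda>(x::real, y::real). Complex x y)"
  define k where "k = (\<lambda>z. (Re z, Im z))"
  have hk: "h (k z) = z" "k (h p) = p" for z p
    by (simp_all add: h_def k_def split: prod.splits)
  have ch: "continuous_on A h" for A
    unfolding h_def case_prod_beta Complex_eq by (intro continuous_intros)
  have ck: "continuous_on A k" for A
    unfolding k_def by (intro continuous_intros)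
  have hom: "S homeomorphic h ` S"
    unfolding homeomorphic_def homeomorphism_def
    by (rule exI[of _ h], rule exI[of _ k]) (auto simp: ch ck hk image_image)
  have "Borsukian S"
    using assms ANR_imp_locally_path_connected simply_connected_imp_Borsukian by blast
  then have "Borsukian (h ` S)"
    using hom homeomorphic_Borsukian_eq by blast
  moreover have "compact (h ` S)"
    using assms(1) ch compact_continuous_image by blast
  ultimately have "connected (- h ` S)"
    using Borsukian_separation_compact by blast
  then have "connected (k ` (- h ` S))"
    using ck connected_continuous_image by blast
  moreover have "k ` (- h ` S) = - S"
  proof (intro equalityI subsetI)
    fix p assume "p \<in> k ` (- h ` S)"
    then show "p \<in> - S" by (metis ComplD ComplI hk(1) image_iff)
  next
    fix p assume "p \<in> - S"
    then have "h p \<in> - h ` S" by (metis ComplD ComplI hk(2) image_iff)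
    then show "p \<in> k ` (- h ` S)" by (metis hk(2) image_eqI)
  qed
  ultimately show ?thesis by simp
qed

lemma unit_square_properties: "compact (unit_square i)" "closed (unit_square i)" "convex (unit_square i)"
  by (auto simp: unit_square_def intro!: compact_Times convex_Times closed_Times)

lemma mem_unit_square:
  "(x, y) \<in> unit_square (i, j) \<longleftrightarrow> \<bar>x - i\<bar> \<le> 1/2 \<and> \<bar>y - j\<bar> \<le> 1/2"
  unfolding unit_square_def by (auto simp del: less_divide_eq_numeral1 le_divide_eq_numeral1)

lemma finite_lattice_bounded: "lattice_bounded \<Lambda> \<Longrightarrow> finite \<Lambda>"
proof -
  assume "lattice_bounded \<Lambda>"
  then obtain r where r: "\<And>p. p \<in> (\<lambda>(x, y). (real_of_int x, real_of_int y)) ` \<Lambda> \<Longrightarrow> norm p \<le> r"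
    unfolding lattice_bounded_def bounded_iff by blast
  have "\<Lambda> \<subseteq> {- \<lceil>r\<rceil>..\<lceil>r\<rceil>} \<times> {- \<lceil>r\<rceil>..\<lceil>r\<rceil>}"
  proof
    fix i assume "i \<in> \<Lambda>"
    obtain x y where i: "i = (x, y)" by force
    then have "norm (real_of_int x, real_of_int y) \<le> r" using r \<open>i \<in> \<Lambda>\<close> by force
    then have "\<bar>real_of_int x\<bar> \<le> r" "\<bar>real_of_int y\<bar> \<le> r"
      using norm_fst_le[of "real_of_int x" "real_of_int y"] norm_snd_le[of "real_of_int y" "real_of_int x"]
      by (auto simp del: norm_Pair)
    then show "i \<in> {- \<lceil>r\<rceil>..\<lceil>r\<rceil>} \<times> {- \<lceil>r\<rceil>..\<lceil>r\<rceil>}"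
      unfolding i by (simp add: abs_le_iff) linarith
  qed
  then show "finite \<Lambda>" by (rule finite_subset) auto
qed

text \<open>In the second case \<open>p\<close> is the common corner of \<open>i\<close>, \<open>j\<close> and \<open>k\<close>.\<close>

lemma unit_square_overlap:
  assumes i: "p \<in> unit_square i" and j: "p \<in> unit_square j" and "i \<noteq> j"
  obtains "nearest_neighbours i j"
  | k where "p \<in> unit_square k" "nearest_neighbours i k" "nearest_neighbours k j"
proof -
  obtain x y where p: "p = (x, y)" by force
  obtain i1 i2 j1 j2 where ij: "i = (i1, i2)" "j = (j1, j2)" by (metis surj_pair)
  have m: "\<bar>x - i1\<bar> \<le> 1/2" "\<bar>y - i2\<bar> \<le> 1/2" "\<bar>x - j1\<bar> \<le> 1/2" "\<bar>y - j2\<bar> \<le> 1/2"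
    using i j by (simp_all add: p ij mem_unit_square)
  then have "\<bar>i1 - j1\<bar> \<le> 1" "\<bar>i2 - j2\<bar> \<le> 1" by linarith+
  show ?thesis
  proof (cases "i1 = j1 \<or> i2 = j2")
    case True
    then have "nearest_neighbours i j"
      using \<open>i \<noteq> j\<close> \<open>\<bar>i1 - j1\<bar> \<le> 1\<close> \<open>\<bar>i2 - j2\<bar> \<le> 1\<close> by (auto simp: ij nearest_neighbours_def)
    then show ?thesis by (rule that)
  next
    case False
    then have "nearest_neighbours i (i1, j2)" "nearest_neighbours (i1, j2) j"
      using \<open>\<bar>i1 - j1\<bar> \<le> 1\<close> \<open>\<bar>i2 - j2\<bar> \<le> 1\<close> by (auto simp: ij nearest_neighbours_def)
    then show ?thesis using m by (intro that(2)[of "(i1, j2)"]) (simp_all add: p mem_unit_square)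
  qed
qed

text \<open>Otherwise every neighbour of \<open>H\<close> outside \<open>\<Lambda>\<close> would
  belong to \<open>H\<close>, and the squares of \<open>H\<close> would be cut off, within the
  complement of the union \<open>U\<close> of the squares of \<open>\<Lambda>\<close>, from the
  squares of all remaining sites. That complement is connected.\<close>

lemma no_holes:
  assumes bdd: "lattice_bounded \<Lambda>" and sc: "lattice_simply_connected \<Lambda>"
    and H: "finite H" "H \<noteq> {}" "H \<inter> \<Lambda> = {}"
  shows "\<exists>h k. h \<in> H \<and> k \<notin> H \<and> k \<notin> \<Lambda> \<and> nearest_neighbours h k"
proof (rule ccontr)
  assume nothesis: "\<not> ?thesis"
  have nn: "k \<in> H" if "h \<in> H" "k \<notin> \<Lambda>" "nearest_neighbours h k" for h k
    using that nothesis by blast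
  have fin: "finite \<Lambda>" using bdd by (rule finite_lattice_bounded)
  define U where "U = (\<Union>i\<in>\<Lambda>. unit_square i)"
  have "ANR U" unfolding U_def
    by (rule ANR_finite_Union_convex_closed) (auto simp: fin unit_square_properties)
  moreover have "compact U" unfolding U_def
    by (intro compact_UN) (auto simp: fin unit_square_properties)
  ultimately have conn: "connected (- U)"
    using sc simply_connected_compact_complement unfolding U_def lattice_simply_connected_def by blast
  obtain N where N: "\<And>i. i \<in> H \<union> \<Lambda> \<Longrightarrow> \<bar>fst i\<bar> \<le> N \<and> \<bar>snd i\<bar> \<le> N"
  proof -
    have "finite ((\<lambda>i. \<bar>fst i\<bar>) ` (H \<union> \<Lambda>) \<union> (\<lambda>i. \<bar>snd i\<bar>) ` (H \<union> \<Lambda>))" using fin H by auto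
    then obtain N where "\<forall>x \<in> (\<lambda>i. \<bar>fst i\<bar>) ` (H \<union> \<Lambda>) \<union> (\<lambda>i. \<bar>snd i\<bar>) ` (H \<union> \<Lambda>). x \<le> N"
      by (meson bdd_above_def bdd_above_finite)
    then show thesis by (intro that[of N]) auto
  qed
  \<comment> \<open>\<open>P\<close> and \<open>Q\<close> disconnect the complement of \<open>U\<close>. The squares far out are replaced by the
    complements of two open strips, so that \<open>Q\<close> is a finite union of closed sets.\<close>
  define I where "I = {-N-2..N+2} \<times> {-N-2..N+2} - H - \<Lambda>"
  define P where "P = (\<Union>h\<in>H. unit_square h)"
  define Q where "Q = (\<Union>h\<in>I. unit_square h) \<union> {p. N + 1 \<le> \<bar>fst p\<bar>} \<union> {p. N + 1 \<le> \<bar>snd p\<bar>}"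
  have "closed P" unfolding P_def using H by (intro closed_UN) (auto simp: unit_square_properties)
  moreover have "closed Q" unfolding Q_def
    by (intro closed_Un closed_UN closed_Collect_le continuous_intros)
       (auto simp: I_def unit_square_properties)
  moreover have "- U \<subseteq> P \<union> Q"
  proof
    fix p assume "p \<in> - U"
    obtain x y where p: "p = (x, y)" by force
    show "p \<in> P \<union> Q"
    proof (cases "N + 1 \<le> \<bar>x\<bar> \<or> N + 1 \<le> \<bar>y\<bar>")
      case True then show ?thesis by (auto simp: Q_def p)
    next
      case False
      \<comment> \<open>A site nearest to \<open>p\<close>: its square contains \<open>p\<close>,
        and it is not in \<open>\<Lambda>\<close> because \<open>p\<close> is not in
        \<open>U\<close>. Rounding stays within the range of \<open>I\<close>, which has a margin of
        2.\<close>
      define i where "i = (round x, round y)"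
      have r: "\<bar>x - round x\<bar> \<le> 1/2" "\<bar>y - round y\<bar> \<le> 1/2"
        using of_int_round_abs_le[of x] of_int_round_abs_le[of y] by (simp_all add: abs_minus_commute)
      then have "p \<in> unit_square i" by (simp add: i_def p mem_unit_square)
      moreover have "i \<in> {-N-2..N+2} \<times> {-N-2..N+2}"
      proof -
        have "\<bar>x\<bar> < N + 1" "\<bar>y\<bar> < N + 1" using False by auto
        then have "- N - 2 \<le> round x" "round x \<le> N + 2" "- N - 2 \<le> round y" "round y \<le> N + 2"
          using r by linarith+
        then show ?thesis by (simp add: i_def)
      qed
      ultimately show ?thesis using \<open>p \<in> - U\<close> unfolding P_def Q_def I_def U_def by auto
    qed
  qed
  moreover have "P \<inter> Q \<inter> - U = {}"
  proof (rule ccontr)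
    assume "P \<inter> Q \<inter> - U \<noteq> {}"
    then obtain p where p: "p \<in> P" "p \<in> Q" "p \<notin> U" by blast
    obtain h where h: "h \<in> H" "p \<in> unit_square h" using p by (auto simp: P_def)
    \<comment> \<open>Squares of \<open>H\<close> reach only to \<open>N + 1/2\<close>, short of the
      far regions of \<open>Q\<close>, so \<open>p\<close> must lie in a square of
      \<open>I\<close>.\<close>
    have "\<bar>fst h\<bar> \<le> N" "\<bar>snd h\<bar> \<le> N"
      "\<bar>fst p - fst h\<bar> \<le> 1/2" "\<bar>snd p - snd h\<bar> \<le> 1/2"
      using N[of h] h mem_unit_square[of "fst p" "snd p" "fst h" "snd h"] by auto
    then have "\<bar>fst p\<bar> < N + 1" "\<bar>snd p\<bar> < N + 1" by linarith+
    then obtain k where k: "k \<in> I" "p \<in> unit_square k" using p by (auto simp: Q_def)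
    then have kk: "k \<notin> H" "k \<notin> \<Lambda>" by (auto simp: I_def)
    then have "h \<noteq> k" using h by auto
    with h(2) k(2) show False
    proof (rule unit_square_overlap)
      assume "nearest_neighbours h k" then show False using nn h kk by blast
    next
      \<comment> \<open>The square of \<open>m\<close> contains \<open>p\<close>, so
        \<open>m\<close> in \<open>\<Lambda>\<close> would put \<open>p\<close> into
        \<open>U\<close>. Hence \<open>nn\<close> applies twice, from \<open>h\<close> to
        \<open>m\<close> and from \<open>m\<close> to \<open>k\<close>.\<close>
      fix m assume m: "p \<in> unit_square m" "nearest_neighbours h m" "nearest_neighbours m k"
      then have "m \<notin> \<Lambda>" using p by (auto simp: U_def)
      then show False using nn h m kk by blast
    qed
  qed
  moreover have "P \<inter> - U \<noteq> {}"
  proof -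
    obtain h where h: "h \<in> H" using H by blast
    obtain h1 h2 where hh: "h = (h1, h2)" by force
    \<comment> \<open>The centre of a square lies in no other square.\<close>
    let ?p = "(real_of_int h1, real_of_int h2)"
    have "?p \<in> P" using h by (auto simp: P_def hh mem_unit_square intro!: bexI[of _ h])
    moreover have "?p \<notin> U"
    proof
      assume "?p \<in> U"
      then obtain i1 i2 where i: "(i1, i2) \<in> \<Lambda>" "?p \<in> unit_square (i1, i2)" by (auto simp: U_def)
      then have "\<bar>real_of_int h1 - i1\<bar> \<le> 1/2" "\<bar>real_of_int h2 - i2\<bar> \<le> 1/2"
        by (simp_all add: mem_unit_square)
      then have "i1 = h1" "i2 = h2" by linarith+
      then show False using i h H hh by auto
    qed
    ultimately show ?thesis by blast
  qed
  moreover have "Q \<inter> - U \<noteq> {}"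
  proof -
    let ?p = "(real_of_int (N + 1), 0::real)"
    have "?p \<in> Q" using abs_ge_self[of "real_of_int N + 1"] by (simp add: Q_def)
    moreover have "?p \<notin> U"
    proof
      assume "?p \<in> U"
      then obtain i1 i2 where i: "(i1, i2) \<in> \<Lambda>" "?p \<in> unit_square (i1, i2)" by (auto simp: U_def)
      then have "\<bar>real_of_int (N + 1) - i1\<bar> \<le> 1/2" "\<bar>i1\<bar> \<le> N"
        using N[of "(i1, i2)"] by (simp_all add: mem_unit_square)
      then show False by linarith
    qed
    ultimately show ?thesis by blast
  qed
  ultimately show False using conn unfolding connected_closed by blast
qed

section \<open>Spins that are constant on clusters\<close>

text \<open>With \<open>d = 1\<close> and \<open>d = undefined\<close> this gives the components of \<open>plus_spins\<close> and \<open>free_spins\<close>,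
  respectively; no property of \<open>undefined\<close> is used.\<close>

definition spin_set :: "real \<Rightarrow> site set \<Rightarrow> (site \<Rightarrow> real) set" where
  "spin_set d \<Lambda> = PiE_dflt \<Lambda> d (\<lambda>_. {-1, 1})"

text \<open>For spins in \<open>{-1, 1}\<close> a product 1 over the two endpoints says that they
  agree.\<close>

definition compatible :: "(bond \<Rightarrow> bool) \<Rightarrow> (site \<Rightarrow> real) \<Rightarrow> bond set \<Rightarrow> bool" where
  "compatible opn s \<B> \<longleftrightarrow> (\<forall>b\<in>\<B>. opn b \<longrightarrow> spin_prod s (endpoints b) = 1)"

text \<open>Overwriting the values off \<open>A\<close> by \<open>d\<close> is a bijection from
  \<open>PiE A B\<close>, which reduces this to ordinary distributivity. The default is needed
  because boundary conditions prescribe the values off a finite set.\<close>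

lemma prod_sum_PiE_dflt:
  fixes f :: "'a \<Rightarrow> 'b \<Rightarrow> 'c::comm_semiring_1"
  assumes "finite A" "\<And>x. x \<in> A \<Longrightarrow> finite (B x)"
  shows "(\<Prod>x\<in>A. \<Sum>y\<in>B x. f x y) = (\<Sum>g\<in>PiE_dflt A d B. \<Prod>x\<in>A. f x (g x))"
proof -
  have "(\<Prod>x\<in>A. \<Sum>y\<in>B x. f x y) = (\<Sum>g\<in>PiE A B. \<Prod>x\<in>A. f x (g x))"
    using assms by (rule prod_sum_PiE)
  also have "\<dots> = (\<Sum>g\<in>PiE_dflt A d B. \<Prod>x\<in>A. f x (g x))"
    by (rule sum.reindex_bij_witness[where j = "\<lambda>h x. if x \<in> A then h x else d" and i = "\<lambda>h. restrict h A"])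
       (auto simp: PiE_dflt_def PiE_def extensional_def restrict_def fun_eq_iff intro!: prod.cong)
  finally show ?thesis .
qed

lemma finite_spin_set: "finite \<Lambda> \<Longrightarrow> finite (spin_set d \<Lambda>)"
  by (auto simp: spin_set_def)

lemma spin_set_inside: "s \<in> spin_set d \<Lambda> \<Longrightarrow> i \<in> \<Lambda> \<or> d = 1 \<Longrightarrow> s i \<in> {-1, 1}"
  unfolding spin_set_def PiE_dflt_def by (cases "i \<in> \<Lambda>") blast+

lemma spin_set_outside: "s \<in> spin_set d \<Lambda> \<Longrightarrow> i \<notin> \<Lambda> \<Longrightarrow> s i = d"
  unfolding spin_set_def PiE_dflt_def by blast

lemma endpoints_cases: obtains i j where "endpoints b = {i, j}" "nearest_neighbours i j"
  using endpoints[of b] by blast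

section \<open>Clusters as equivalence classes of connected sites\<close>

definition adjacency :: "(bond \<Rightarrow> bool) \<Rightarrow> (site \<times> site) set" where
  "adjacency opn = {(i, j). \<exists>b. opn b \<and> endpoints b = {i, j}}"

lemma adjacencyI: "opn b \<Longrightarrow> endpoints b = {i, j} \<Longrightarrow> (i, j) \<in> adjacency opn"
  by (auto simp: adjacency_def)

lemma clusters_eq: "clusters opn = UNIV // (adjacency opn)\<^sup>*"
  by (simp add: clusters_def adjacency_def)

lemma equiv_adjacency: "equiv UNIV ((adjacency opn)\<^sup>*)"
proof (rule equivI)
  have "sym (adjacency opn)" by (auto simp: sym_def adjacency_def insert_commute)
  then show "sym ((adjacency opn)\<^sup>*)" by (rule sym_rtrancl)
qed (auto simp: refl_on_def trans_rtrancl)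

definition cluster :: "(bond \<Rightarrow> bool) \<Rightarrow> site \<Rightarrow> site set" where
  "cluster opn i = (adjacency opn)\<^sup>* `` {i}"

lemma cluster_self: "i \<in> cluster opn i" by (simp add: cluster_def)

lemma cluster_in_clusters: "cluster opn i \<in> clusters opn"
  by (auto simp: clusters_eq cluster_def intro: quotientI)

lemma clusters_cluster: "C \<in> clusters opn \<Longrightarrow> i \<in> C \<Longrightarrow> C = cluster opn i"
  unfolding clusters_eq cluster_def
  by (metis equiv_adjacency quotientE Image_singleton_iff equiv_class_eq)

lemma cluster_adjacent: "opn b \<Longrightarrow> endpoints b = {i, j} \<Longrightarrow> cluster opn i = cluster opn j"
  unfolding cluster_def using equiv_class_eq[OF equiv_adjacency] adjacencyI by blast

text \<open>The sum over the spins factorises over the finite clusters \<open>C\<close> meeting \<open>\<Lambda>\<close>, and \<open>C\<close>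
  contributes \<open>(-1)\<^bsup>card (C \<inter> A)\<^esup> + 1\<^bsup>card (C \<inter> A)\<^esup>\<close>, which is 2 or 0.\<close>

lemma sum_compatible_spins:
  assumes fin: "finite \<Lambda>" and A: "A \<subseteq> \<Lambda>"
    and inside: "\<And>C. C \<in> clusters opn \<Longrightarrow> finite C \<Longrightarrow> C \<inter> \<Lambda> \<noteq> {} \<Longrightarrow> C \<subseteq> \<Lambda>"
    and outside: "d = 1 \<or> (\<forall>C\<in>clusters opn. finite C)"
    and opn: "\<And>b. opn b \<Longrightarrow> b \<notin> \<B> \<Longrightarrow> endpoints b \<inter> \<Lambda> = {} \<and> d = 1"
    and touch: "\<And>b. b \<in> \<B> \<Longrightarrow> d \<noteq> 1 \<Longrightarrow> endpoints b \<subseteq> \<Lambda>"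
  shows "(\<Sum>s | s \<in> spin_set d \<Lambda> \<and> compatible opn s \<B>. spin_prod s A) =
           kappa A opn * 2 ^ num_clusters opn \<Lambda>"
proof -
  define F where "F = {C \<in> clusters opn. finite C \<and> C \<inter> \<Lambda> \<noteq> {}}"
  \<comment> \<open>Spins obtained from one sign per cluster in \<open>F\<close>; all other sites
    get the default \<open>d\<close>.\<close>
  define ext where "ext = (\<lambda>f i. if cluster opn i \<in> F then f (cluster opn i) else d :: real)"
  define S where "S = {s \<in> spin_set d \<Lambda>. compatible opn s \<B>}"
  have F_sub: "C \<subseteq> \<Lambda>" if "C \<in> F" for C using inside that by (auto simp: F_def)
  have "F \<subseteq> Pow \<Lambda>" using F_sub by blast
  then have finF: "finite F" using fin finite_subset by auto
  have cl: "C = cluster opn i" if "C \<in> F" "i \<in> C" for C i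
    using clusters_cluster that by (auto simp: F_def)
  \<comment> \<open>Inside \<open>\<Lambda>\<close>, \<open>ext\<close> therefore falls back on the
    default only if it is the genuine spin 1.\<close>
  have clF: "cluster opn i \<in> F" if "i \<in> \<Lambda>" "d \<noteq> 1" for i
    using that outside cluster_self[of i opn] cluster_in_clusters[of opn i] by (auto simp: F_def)
  have ne: "C \<noteq> {}" if "C \<in> F" for C using that by (auto simp: F_def)
  \<comment> \<open>Across an open bond of \<open>\<B>\<close> the spins agree by compatibility;
    across any other open bond both endpoints lie outside \<open>\<Lambda>\<close> and carry the
    value \<open>d\<close>.\<close>
  have const: "s i = s j" if s: "s \<in> S" and ij: "(i, j) \<in> (adjacency opn)\<^sup>*" for s i j
    using ij
  proof (induction rule: rtrancl_induct)
    case (step j k)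
    then obtain b where b: "opn b" "endpoints b = {j, k}" by (auto simp: adjacency_def)
    obtain i' j' where "endpoints b = {i', j'}" "nearest_neighbours i' j'" by (rule endpoints_cases)
    then have "j \<noteq> k" using b(2) by (auto simp: nearest_neighbours_def doubleton_eq_iff)
    have "s j = s k"
    proof (cases "b \<in> \<B>")
      case True
      then have "s j * s k = 1" using s b \<open>j \<noteq> k\<close> by (auto simp: S_def compatible_def spin_prod_def)
      moreover have "s j \<in> {-1, 1}" "s k \<in> {-1, 1}" 
        using touch[OF True] b s spin_set_inside[of s d \<Lambda>] unfolding S_def by blast+
      ultimately show ?thesis by auto
    next
      case False
      then show ?thesis using opn[OF b(1) False] s b by (auto simp: S_def spin_set_outside)
    qed
    with step show ?case by simp
  qed simp
  have const': "s i = s j" if "s \<in> S" "i \<in> C" "j \<in> C" "C \<in> F" for s i j C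
    using const[OF that(1), of i j] cl[OF that(4,2)] that(3) by (auto simp: cluster_def)
  \<comment> \<open>Bijection between compatible spins and signs on \<open>F\<close>: read off the
    spin at a chosen site of each cluster, and go back by \<open>ext\<close>.\<close>
  have "(\<Sum>s\<in>S. spin_prod s A) = (\<Sum>f\<in>F \<rightarrow>\<^sub>E {-1, 1}. spin_prod (ext f) A)"
  proof (rule sum.reindex_bij_witness[where j = "\<lambda>s. restrict (\<lambda>C. s (SOME i. i \<in> C)) F" and i = ext])
    fix s assume s: "s \<in> S"
    show eq: "ext (\<lambda>C\<in>F. s (SOME i. i \<in> C)) = s"
    proof
      fix i
      show "ext (\<lambda>C\<in>F. s (SOME i. i \<in> C)) i = s i"
      proof (cases "cluster opn i \<in> F")
        case True
        have "(SOME j. j \<in> cluster opn i) \<in> cluster opn i"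
          using cluster_self by (metis someI)
        then show ?thesis using True const'[OF s _ cluster_self True] by (simp add: ext_def)
      next
        case False
        show ?thesis
        proof (cases "i \<in> \<Lambda>")
          case True
          \<comment> \<open>A cluster that meets \<open>\<Lambda>\<close> but is not in
            \<open>F\<close> is infinite, so it leaves the finite set \<open>\<Lambda>\<close> and
            takes over the value \<open>d\<close> from outside.\<close>
          then have "infinite (cluster opn i)"
            using False cluster_self[of i opn] cluster_in_clusters[of opn i] unfolding F_def by blast
          then have "\<not> cluster opn i \<subseteq> \<Lambda>" using fin finite_subset by blast
          have "d = 1" using True False clF by blast
          obtain j where "j \<in> cluster opn i" "j \<notin> \<Lambda>"
            using \<open>\<not> cluster opn i \<subseteq> \<Lambda>\<close> by blast
          then have "s i = d" using const[OF s, of i j] s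
            by (auto simp: cluster_def S_def spin_set_outside)
          then show ?thesis using False by (simp add: ext_def)
        next
          case False
          then have "s i = d" using s by (auto simp: S_def spin_set_outside)
          then show ?thesis using \<open>cluster opn i \<notin> F\<close> by (simp add: ext_def)
        qed
      qed
    qed
    show "(\<lambda>C\<in>F. s (SOME i. i \<in> C)) \<in> F \<rightarrow>\<^sub>E {-1, 1}"
    proof (intro restrict_PiE_iff[THEN iffD2] ballI)
      fix C assume "C \<in> F"
      then have "(SOME i. i \<in> C) \<in> C" using ne by (simp add: some_in_eq)
      then have "(SOME i. i \<in> C) \<in> \<Lambda>" using F_sub \<open>C \<in> F\<close> by blast
      then show "s (SOME i. i \<in> C) \<in> {-1, 1}" using s spin_set_inside unfolding S_def by blast
    qed
    show "spin_prod (ext (\<lambda>C\<in>F. s (SOME i. i \<in> C))) A = spin_prod s A" by (simp add: eq)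
  next
    fix f assume f: "f \<in> F \<rightarrow>\<^sub>E {-1, 1::real}"
    have val: "ext f i \<in> {-1, 1}" if "cluster opn i \<in> F" for i
      using f that by (auto simp: ext_def PiE_def Pi_def)
    have "ext f \<in> spin_set d \<Lambda>"
    proof -
      have "ext f i \<in> {-1, 1}" if "i \<in> \<Lambda>" for i
        using val[of i] clF[OF that] by (cases "cluster opn i \<in> F") (auto simp: ext_def)
      moreover have "ext f i = d" if "i \<notin> \<Lambda>" for i
        using that F_sub[of "cluster opn i"] cluster_self[of i opn] by (auto simp: ext_def)
      ultimately show ?thesis by (auto simp: spin_set_def PiE_dflt_def)
    qed
    moreover have "compatible opn (ext f) \<B>" unfolding compatible_def
    proof (intro ballI impI)
      fix b assume b: "b \<in> \<B>" "opn b"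
      obtain i j where ij: "endpoints b = {i, j}" "nearest_neighbours i j" by (rule endpoints_cases)
      then have "i \<noteq> j" by (auto simp: nearest_neighbours_def)
      have "ext f i = ext f j" using cluster_adjacent[of opn b i j] b(2) ij(1) by (simp add: ext_def)
      \<comment> \<open>Either \<open>d = 1\<close>, or the bond lies inside
        \<open>\<Lambda>\<close> and the cluster of \<open>i\<close> is in \<open>F\<close>.\<close>
      moreover have "ext f i \<in> {-1, 1}"
        using val[of i] clF[of i] touch[OF b(1)] ij by (cases "cluster opn i \<in> F") (auto simp: ext_def)
      ultimately show "spin_prod (ext f) (endpoints b) = 1"
        using ij \<open>i \<noteq> j\<close> by (auto simp: spin_prod_def)
    qed
    ultimately show "ext f \<in> S" by (simp add: S_def)
    show "(\<lambda>C\<in>F. ext f (SOME i. i \<in> C)) = f"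
    proof
      fix C
      show "(\<lambda>C\<in>F. ext f (SOME i. i \<in> C)) C = f C"
      proof (cases "C \<in> F")
        case True
        then have "(SOME i. i \<in> C) \<in> C" using ne by (simp add: some_in_eq)
        then have "C = cluster opn (SOME i. i \<in> C)" using cl True by blast
        then show ?thesis using True by (simp add: ext_def)
      next
        case False
        then show ?thesis using f by (auto simp: PiE_def extensional_def)
      qed
    qed
  qed
  also have "\<dots> = (\<Sum>f\<in>F \<rightarrow>\<^sub>E {-1, 1}. \<Prod>C\<in>F. f C ^ card (C \<inter> A))"
  proof (rule sum.cong)
    fix f :: "site set \<Rightarrow> real"
    have finA: "finite A" using A fin finite_subset by blast
    \<comment> \<open>Sites of \<open>A\<close> outside all clusters of \<open>F\<close> have spin
      \<open>d = 1\<close> and drop out; the others are grouped by cluster.\<close>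
    have "spin_prod (ext f) A = (\<Prod>i\<in>A \<inter> \<Union>F. ext f i)"
      unfolding spin_prod_def
    proof (rule prod.mono_neutral_right)
      show "\<forall>i\<in>A - A \<inter> \<Union>F. ext f i = 1"
      proof
        fix i assume i: "i \<in> A - A \<inter> \<Union>F"
        then have "cluster opn i \<notin> F" using cluster_self[of i opn] by blast
        moreover from this have "d = 1" using clF[of i] i A by blast
        ultimately show "ext f i = 1" by (simp add: ext_def)
      qed
    qed (use finA in auto)
    also have "\<dots> = (\<Prod>i\<in>(\<Union>C\<in>F. C \<inter> A). ext f i)"
      by (rule prod.cong) auto
    also have "\<dots> = (\<Prod>C\<in>F. \<Prod>i\<in>C \<inter> A. ext f i)"
    proof (rule prod.UNION_disjoint)
      show "\<forall>C\<in>F. \<forall>D\<in>F. C \<noteq> D \<longrightarrow> C \<inter> A \<inter> (D \<inter> A) = {}" using cl by blast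
    qed (use finF finA in auto)
    also have "\<dots> = (\<Prod>C\<in>F. f C ^ card (C \<inter> A))"
    proof (rule prod.cong[OF refl])
      fix C assume "C \<in> F"
      then have "ext f i = f C" if "i \<in> C \<inter> A" for i
        using that cl[of C i] by (simp add: ext_def)
      then show "(\<Prod>i\<in>C \<inter> A. ext f i) = f C ^ card (C \<inter> A)" by simp
    qed
    finally show "spin_prod (ext f) A = (\<Prod>C\<in>F. f C ^ card (C \<inter> A))" .
  qed simp
  also have "\<dots> = (\<Prod>C\<in>F. \<Sum>x\<in>{-1, 1::real}. x ^ card (C \<inter> A))"
    using finF by (intro prod_sum_PiE[symmetric]) auto
  also have "\<dots> = (\<Prod>C\<in>F. if odd (card (C \<inter> A)) then 0 else 2)"
    by (intro prod.cong) auto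
  also have "\<dots> = kappa A opn * 2 ^ card F"
  proof (cases "\<exists>C\<in>F. odd (card (C \<inter> A))")
    case True
    then have "kappa A opn = 0" by (auto simp: kappa_def F_def)
    moreover have "(\<Prod>C\<in>F. if odd (card (C \<inter> A)) then 0 else 2) = (0::real)"
      using True finF by (intro prod_zero) auto
    ultimately show ?thesis by simp
  next
    case False
    \<comment> \<open>An odd intersection with \<open>A\<close> is nonempty and so meets
      \<open>\<Lambda>\<close>; thus \<open>kappa\<close>, which looks at all finite clusters, is
      decided by those in \<open>F\<close>.\<close>
    have "C \<in> F" if "C \<in> clusters opn" "finite C" "odd (card (C \<inter> A))" for C
    proof -
      have "C \<inter> A \<noteq> {}" using that(3) by auto
      then show ?thesis using that A by (auto simp: F_def)
    qed
    then have "kappa A opn = 1" using False by (auto simp: kappa_def)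
    moreover have "(\<Prod>C\<in>F. if odd (card (C \<inter> A)) then 0 else 2) = (\<Prod>C\<in>F. 2::real)"
      using False by (intro prod.cong) auto
    ultimately show ?thesis by simp
  qed
  finally show ?thesis by (simp add: S_def F_def num_clusters_def)
qed

section \<open>The Edwards--Sokal coupling\<close>

definition grc_bond_weight :: "real \<Rightarrow> real \<Rightarrow> real \<Rightarrow> real \<Rightarrow> bool \<times> bool \<Rightarrow> real" where
  "grc_bond_weight a\<^sub>0 a\<^sub>\<sigma> a\<^sub>\<tau> a\<^sub>\<sigma>\<^sub>\<tau> n =
     (if fst n then (if snd n then a\<^sub>\<sigma>\<^sub>\<tau> else a\<^sub>\<sigma>) else (if snd n then a\<^sub>\<tau> else a\<^sub>0))"

lemma grc_weight_eq_prod: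
  assumes "finite \<B>"
  shows "grc_weight a\<^sub>0 a\<^sub>\<sigma> a\<^sub>\<tau> a\<^sub>\<sigma>\<^sub>\<tau> \<B> n = (\<Prod>b\<in>\<B>. grc_bond_weight a\<^sub>0 a\<^sub>\<sigma> a\<^sub>\<tau> a\<^sub>\<sigma>\<^sub>\<tau> (n b))"
proof -
  have *: "(\<Prod>b\<in>{b\<in>\<B>. n b = v}. a) = (\<Prod>b\<in>\<B>. if n b = v then a else 1)" for a :: real and v
    using assms by (simp add: prod.If_cases Int_def)
  show ?thesis
    unfolding grc_weight_def * prod.distrib[symmetric]
    by (intro prod.cong refl) (auto simp: grc_bond_weight_def prod_eq_iff)
qed

text \<open>A component may be open only if its spins agree across the bond. The admissible masses
  for \<open>(P, Q)\<close> equal to (-1,-1), (1,-1), (-1,1), (1,1) thus add up to the four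
  left-hand sums in \<open>E\<close>. Solving this triangular system gives exactly the stated
  formulas for the masses.\<close>

lemma bond_expansion:
  fixes J\<^sub>\<sigma> J\<^sub>\<tau> J\<^sub>\<sigma>\<^sub>\<tau> a\<^sub>0 a\<^sub>\<sigma> a\<^sub>\<tau> a\<^sub>\<sigma>\<^sub>\<tau> P Q :: real
  assumes "a\<^sub>0 = exp (-2 * (J\<^sub>\<sigma> + J\<^sub>\<tau>))"
    and "a\<^sub>\<sigma> = exp (-2 * J\<^sub>\<tau>) * (exp (-2 * J\<^sub>\<sigma>\<^sub>\<tau>) - exp (-2 * J\<^sub>\<sigma>))"
    and "a\<^sub>\<tau> = exp (-2 * J\<^sub>\<sigma>) * (exp (-2 * J\<^sub>\<sigma>\<^sub>\<tau>) - exp (-2 * J\<^sub>\<tau>))"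
    and "a\<^sub>\<sigma>\<^sub>\<tau> = 1 - exp (-2 * (J\<^sub>\<sigma> + J\<^sub>\<sigma>\<^sub>\<tau>)) - exp (-2 * (J\<^sub>\<tau> + J\<^sub>\<sigma>\<^sub>\<tau>)) + exp (-2 * (J\<^sub>\<sigma> + J\<^sub>\<tau>))"
    and PQ: "P \<in> {-1, 1}" "Q \<in> {-1, 1}"
  shows "exp (J\<^sub>\<sigma> * P + J\<^sub>\<tau> * Q + J\<^sub>\<sigma>\<^sub>\<tau> * P * Q) = exp (J\<^sub>\<sigma> + J\<^sub>\<tau> + J\<^sub>\<sigma>\<^sub>\<tau>) *
    (\<Sum>n\<in>UNIV. grc_bond_weight a\<^sub>0 a\<^sub>\<sigma> a\<^sub>\<tau> a\<^sub>\<sigma>\<^sub>\<tau> n * of_bool (fst n \<longrightarrow> P = 1) * of_bool (snd n \<longrightarrow> Q = 1))"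
proof -
  have U: "(UNIV :: (bool \<times> bool) set) = {(False, False), (True, False), (False, True), (True, True)}"
    by auto
  have E: "exp (J\<^sub>\<sigma> + J\<^sub>\<tau> + J\<^sub>\<sigma>\<^sub>\<tau>) * a\<^sub>0 = exp (- J\<^sub>\<sigma> - J\<^sub>\<tau> + J\<^sub>\<sigma>\<^sub>\<tau>)"
    "exp (J\<^sub>\<sigma> + J\<^sub>\<tau> + J\<^sub>\<sigma>\<^sub>\<tau>) * (a\<^sub>0 + a\<^sub>\<sigma>) = exp (J\<^sub>\<sigma> - J\<^sub>\<tau> - J\<^sub>\<sigma>\<^sub>\<tau>)"
    "exp (J\<^sub>\<sigma> + J\<^sub>\<tau> + J\<^sub>\<sigma>\<^sub>\<tau>) * (a\<^sub>0 + a\<^sub>\<tau>) = exp (- J\<^sub>\<sigma> + J\<^sub>\<tau> - J\<^sub>\<sigma>\<^sub>\<tau>)"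
    "a\<^sub>0 + a\<^sub>\<sigma> + a\<^sub>\<tau> + a\<^sub>\<sigma>\<^sub>\<tau> = 1"
    by (simp_all add: assms algebra_simps flip: exp_add)
  show ?thesis
    using PQ E by (auto simp: U grc_bond_weight_def add.assoc)
qed

lemma prod_of_bool_Ball:
  assumes "finite A"
  shows "(\<Prod>x\<in>A. of_bool (P x) :: 'a::comm_semiring_1) = of_bool (\<forall>x\<in>A. P x)"
  using assms by (induction A rule: finite_induct) auto

text \<open>\<open>bond_expansion\<close> is multiplied out over \<open>\<B>\<close>; the indicators
  of the single bonds combine into compatibility of each spin component. The value \<open>c\<close>
  is what the boundary condition imposes on bonds outside \<open>\<B>\<close>.\<close>

lemma AT_weight_expansion:
  fixes J\<^sub>\<sigma> J\<^sub>\<tau> J\<^sub>\<sigma>\<^sub>\<tau> a\<^sub>0 a\<^sub>\<sigma> a\<^sub>\<tau> a\<^sub>\<sigma>\<^sub>\<tau> :: real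
  assumes a: "a\<^sub>0 = exp (-2 * (J\<^sub>\<sigma> + J\<^sub>\<tau>))"
    "a\<^sub>\<sigma> = exp (-2 * J\<^sub>\<tau>) * (exp (-2 * J\<^sub>\<sigma>\<^sub>\<tau>) - exp (-2 * J\<^sub>\<sigma>))"
    "a\<^sub>\<tau> = exp (-2 * J\<^sub>\<sigma>) * (exp (-2 * J\<^sub>\<sigma>\<^sub>\<tau>) - exp (-2 * J\<^sub>\<tau>))"
    "a\<^sub>\<sigma>\<^sub>\<tau> = 1 - exp (-2 * (J\<^sub>\<sigma> + J\<^sub>\<sigma>\<^sub>\<tau>)) - exp (-2 * (J\<^sub>\<tau> + J\<^sub>\<sigma>\<^sub>\<tau>)) + exp (-2 * (J\<^sub>\<sigma> + J\<^sub>\<tau>))"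
    and fin: "finite \<B>"
    and s: "\<And>b. b \<in> \<B> \<Longrightarrow> spin_prod s (endpoints b) \<in> {-1, 1}"
    and t: "\<And>b. b \<in> \<B> \<Longrightarrow> spin_prod t (endpoints b) \<in> {-1, 1}"
  shows "AT_weight J\<^sub>\<sigma> J\<^sub>\<tau> J\<^sub>\<sigma>\<^sub>\<tau> \<B> (s, t) = exp (J\<^sub>\<sigma> + J\<^sub>\<tau> + J\<^sub>\<sigma>\<^sub>\<tau>) ^ card \<B> *
    (\<Sum>n\<in>PiE_dflt \<B> c (\<lambda>_. UNIV). grc_weight a\<^sub>0 a\<^sub>\<sigma> a\<^sub>\<tau> a\<^sub>\<sigma>\<^sub>\<tau> \<B> n *
       of_bool (compatible (fst \<circ> n) s \<B>) * of_bool (compatible (snd \<circ> n) t \<B>))"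
proof -
  let ?w = "grc_bond_weight a\<^sub>0 a\<^sub>\<sigma> a\<^sub>\<tau> a\<^sub>\<sigma>\<^sub>\<tau>"
  let ?g = "\<lambda>b n. ?w n * of_bool (fst n \<longrightarrow> spin_prod s (endpoints b) = 1) *
                       of_bool (snd n \<longrightarrow> spin_prod t (endpoints b) = 1)"
  have "AT_weight J\<^sub>\<sigma> J\<^sub>\<tau> J\<^sub>\<sigma>\<^sub>\<tau> \<B> (s, t) = (\<Prod>b\<in>\<B>. exp (J\<^sub>\<sigma> + J\<^sub>\<tau> + J\<^sub>\<sigma>\<^sub>\<tau>) * (\<Sum>n\<in>UNIV. ?g b n))"
    unfolding AT_weight_def prod.case by (intro prod.cong refl bond_expansion a s t)
  also have "\<dots> = exp (J\<^sub>\<sigma> + J\<^sub>\<tau> + J\<^sub>\<sigma>\<^sub>\<tau>) ^ card \<B> * (\<Prod>b\<in>\<B>. \<Sum>n\<in>UNIV. ?g b n)"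
    by (simp add: prod.distrib)
  also have "(\<Prod>b\<in>\<B>. \<Sum>n\<in>UNIV. ?g b n) = (\<Sum>n\<in>PiE_dflt \<B> c (\<lambda>_. UNIV). \<Prod>b\<in>\<B>. ?g b (n b))"
    using fin by (rule prod_sum_PiE_dflt) auto
  also have "\<dots> = (\<Sum>n\<in>PiE_dflt \<B> c (\<lambda>_. UNIV). grc_weight a\<^sub>0 a\<^sub>\<sigma> a\<^sub>\<tau> a\<^sub>\<sigma>\<^sub>\<tau> \<B> n *
       of_bool (compatible (fst \<circ> n) s \<B>) * of_bool (compatible (snd \<circ> n) t \<B>))"
    using fin by (simp only: prod.distrib prod_of_bool_Ball grc_weight_eq_prod compatible_def o_apply)
  finally show ?thesis .
qed

lemma spin_prod_bond:
  assumes "s \<in> spin_set d \<Lambda>" "d = 1 \<or> endpoints b \<subseteq> \<Lambda>"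
  shows "spin_prod s (endpoints b) \<in> {-1, 1}"
proof -
  obtain i j where ij: "endpoints b = {i, j}" "nearest_neighbours i j" by (rule endpoints_cases)
  then have "i \<noteq> j" by (auto simp: nearest_neighbours_def)
  moreover have "s k \<in> {-1, 1}" if "k \<in> {i, j}" for k
    using assms(2) that ij by (intro spin_set_inside[OF assms(1)]) auto
  then have "s i \<in> {-1, 1}" "s j \<in> {-1, 1}" by simp_all
  ultimately show ?thesis using ij by (auto simp: spin_prod_def)
qed

text \<open>The two spin components interact only through \<open>n\<close>: for fixed
  \<open>n\<close> the summand factorises, so summing over spins first leaves two separate sums,
  each evaluated by \<open>sum_spins\<close>. The parameters \<open>c\<close> and \<open>d\<close>
  cover both boundary conditions.\<close>

lemma edwards_sokal:
  fixes J\<^sub>\<sigma> J\<^sub>\<tau> J\<^sub>\<sigma>\<^sub>\<tau> a\<^sub>0 a\<^sub>\<sigma> a\<^sub>\<tau> a\<^sub>\<sigma>\<^sub>\<tau> :: real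
  assumes a: "a\<^sub>0 = exp (-2 * (J\<^sub>\<sigma> + J\<^sub>\<tau>))"
    "a\<^sub>\<sigma> = exp (-2 * J\<^sub>\<tau>) * (exp (-2 * J\<^sub>\<sigma>\<^sub>\<tau>) - exp (-2 * J\<^sub>\<sigma>))"
    "a\<^sub>\<tau> = exp (-2 * J\<^sub>\<sigma>) * (exp (-2 * J\<^sub>\<sigma>\<^sub>\<tau>) - exp (-2 * J\<^sub>\<tau>))"
    "a\<^sub>\<sigma>\<^sub>\<tau> = 1 - exp (-2 * (J\<^sub>\<sigma> + J\<^sub>\<sigma>\<^sub>\<tau>)) - exp (-2 * (J\<^sub>\<tau> + J\<^sub>\<sigma>\<^sub>\<tau>)) + exp (-2 * (J\<^sub>\<sigma> + J\<^sub>\<tau>))"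
    and fin: "finite \<B>" "finite \<Lambda>"
    and touch: "\<And>b. b \<in> \<B> \<Longrightarrow> d = 1 \<or> endpoints b \<subseteq> \<Lambda>"
    and sum_spins: "\<And>n opn A. n \<in> PiE_dflt \<B> c (\<lambda>_. UNIV) \<Longrightarrow> opn \<in> {fst \<circ> n, snd \<circ> n} \<Longrightarrow> A \<subseteq> \<Lambda> \<Longrightarrow>
       (\<Sum>s | s \<in> spin_set d \<Lambda> \<and> compatible opn s \<B>. spin_prod s A) = kappa A opn * 2 ^ num_clusters opn \<Lambda>"
    and AB: "A \<subseteq> \<Lambda>" "B \<subseteq> \<Lambda>"
  shows "(\<Sum>(s, t)\<in>spin_set d \<Lambda> \<times> spin_set d \<Lambda>.
            AT_weight J\<^sub>\<sigma> J\<^sub>\<tau> J\<^sub>\<sigma>\<^sub>\<tau> \<B> (s, t) * (spin_prod s A * spin_prod t B)) =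
         exp (J\<^sub>\<sigma> + J\<^sub>\<tau> + J\<^sub>\<sigma>\<^sub>\<tau>) ^ card \<B> *
         (\<Sum>n\<in>PiE_dflt \<B> c (\<lambda>_. UNIV). grc_weight a\<^sub>0 a\<^sub>\<sigma> a\<^sub>\<tau> a\<^sub>\<sigma>\<^sub>\<tau> \<B> n * cluster_weight 2 2 \<Lambda> n *
            (kappa A (fst \<circ> n) * kappa B (snd \<circ> n)))"
proof -
  let ?S = "spin_set d \<Lambda>" and ?N = "PiE_dflt \<B> c (\<lambda>_. UNIV)"
  let ?E = "exp (J\<^sub>\<sigma> + J\<^sub>\<tau> + J\<^sub>\<sigma>\<^sub>\<tau>) ^ card \<B>" and ?w = "grc_weight a\<^sub>0 a\<^sub>\<sigma> a\<^sub>\<tau> a\<^sub>\<sigma>\<^sub>\<tau> \<B>"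
  let ?f = "\<lambda>n s. of_bool (compatible (fst \<circ> n) s \<B>) * spin_prod s A"
  let ?g = "\<lambda>n t. of_bool (compatible (snd \<circ> n) t \<B>) * spin_prod t B"
  have finS: "finite ?S" using fin by (intro finite_spin_set)
  have restr: "(\<Sum>s\<in>?S. of_bool (compatible opn s \<B>) * spin_prod s A) =
      (\<Sum>s | s \<in> ?S \<and> compatible opn s \<B>. spin_prod s A)" for opn A
    using finS by (simp add: sum.inter_filter of_bool_def if_distrib[of "\<lambda>x. x * _"] cong: if_cong)
  have "(\<Sum>(s, t)\<in>?S \<times> ?S. AT_weight J\<^sub>\<sigma> J\<^sub>\<tau> J\<^sub>\<sigma>\<^sub>\<tau> \<B> (s, t) * (spin_prod s A * spin_prod t B)) =
      (\<Sum>s\<in>?S. \<Sum>t\<in>?S. AT_weight J\<^sub>\<sigma> J\<^sub>\<tau> J\<^sub>\<sigma>\<^sub>\<tau> \<B> (s, t) * (spin_prod s A * spin_prod t B))"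
    by (rule sum.cartesian_product[symmetric])
  also have "\<dots> = (\<Sum>s\<in>?S. \<Sum>t\<in>?S. ?E * (\<Sum>n\<in>?N. ?w n * (?f n s * ?g n t)))"
  proof (intro sum.cong refl)
    fix s t assume "s \<in> ?S" "t \<in> ?S"
    then have "AT_weight J\<^sub>\<sigma> J\<^sub>\<tau> J\<^sub>\<sigma>\<^sub>\<tau> \<B> (s, t) = ?E *
      (\<Sum>n\<in>?N. ?w n * of_bool (compatible (fst \<circ> n) s \<B>) * of_bool (compatible (snd \<circ> n) t \<B>))"
      using touch by (intro AT_weight_expansion a fin spin_prod_bond)
    then show "AT_weight J\<^sub>\<sigma> J\<^sub>\<tau> J\<^sub>\<sigma>\<^sub>\<tau> \<B> (s, t) * (spin_prod s A * spin_prod t B) =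
        ?E * (\<Sum>n\<in>?N. ?w n * (?f n s * ?g n t))"
      by (simp only: mult.assoc sum_distrib_right) (simp only: mult_ac)
  qed
  also have "\<dots> = ?E * (\<Sum>s\<in>?S. \<Sum>t\<in>?S. \<Sum>n\<in>?N. ?w n * (?f n s * ?g n t))"
    by (simp only: sum_distrib_left)
  also have "(\<Sum>s\<in>?S. \<Sum>t\<in>?S. \<Sum>n\<in>?N. ?w n * (?f n s * ?g n t)) =
      (\<Sum>n\<in>?N. \<Sum>s\<in>?S. \<Sum>t\<in>?S. ?w n * (?f n s * ?g n t))"
    by (simp only: sum.swap[where A = ?S and B = ?N])
  also have "\<dots> = (\<Sum>n\<in>?N. ?w n * ((\<Sum>s\<in>?S. ?f n s) * (\<Sum>t\<in>?S. ?g n t)))"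
    by (simp only: sum_product) (simp only: sum_distrib_left)
  also have "\<dots> = (\<Sum>n\<in>?N. ?w n * cluster_weight 2 2 \<Lambda> n * (kappa A (fst \<circ> n) * kappa B (snd \<circ> n)))"
    using AB by (intro sum.cong refl) (simp add: restr sum_spins cluster_weight_def)
  finally show ?thesis .
qed

section \<open>From weighted sums to expectations\<close>

lemma expectation_weighted_pmf:
  assumes "finite S" "\<And>x. x \<in> S \<Longrightarrow> 0 \<le> w x" "0 < (\<Sum>y\<in>S. w y)"
  shows "measure_pmf.expectation (weighted_pmf S w) f = (\<Sum>x\<in>S. w x * f x) / (\<Sum>x\<in>S. w x)"
proof -
  have "measure_pmf.expectation (weighted_pmf S w) f = (\<Sum>x\<in>S. f x * pmf (weighted_pmf S w) x)"
    using assms by (intro integral_measure_pmf_real) (auto simp: set_pmf_iff pmf_weighted_pmf split: if_splits)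
  also have "\<dots> = (\<Sum>x\<in>S. w x * f x / (\<Sum>x\<in>S. w x))"
    using assms by (intro sum.cong) (auto simp: pmf_weighted_pmf)
  finally show ?thesis by (simp add: sum_divide_distrib)
qed

text \<open>The case \<open>A = B = {}\<close> of the hypothesis relates the two normalisations.\<close>

lemma expectation_eq_of_edwards_sokal:
  fixes w :: "spins \<Rightarrow> real" and v :: "grc_config \<Rightarrow> real"
  assumes fin: "finite S" "finite N" and S: "S \<noteq> {}" and w: "\<And>x. 0 < w x" and v: "\<And>n. 0 \<le> v n" and "0 < E"
    and es: "\<And>A B. A \<subseteq> \<Lambda> \<Longrightarrow> B \<subseteq> \<Lambda> \<Longrightarrow>
      (\<Sum>(s, t)\<in>S. w (s, t) * (spin_prod s A * spin_prod t B)) =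
      E * (\<Sum>n\<in>N. v n * (kappa A (fst \<circ> n) * kappa B (snd \<circ> n)))"
    and AB: "A \<subseteq> \<Lambda>" "B \<subseteq> \<Lambda>"
  shows "measure_pmf.expectation (weighted_pmf S w) (\<lambda>(s, t). spin_prod s A * spin_prod t B) =
         measure_pmf.expectation (weighted_pmf N v) (\<lambda>n. kappa A (fst \<circ> n) * kappa B (snd \<circ> n))"
    and "(\<Sum>x\<in>S. w x) = E * (\<Sum>n\<in>N. v n)"
proof -
  show Z: "(\<Sum>x\<in>S. w x) = E * (\<Sum>n\<in>N. v n)"
    using es[of "{}" "{}"] by (simp add: spin_prod_def kappa_def case_prod_unfold)
  have "0 < (\<Sum>x\<in>S. w x)" using fin S w by (intro sum_pos) auto
  \<comment> \<open>A single \<open>v n\<close> may vanish; positivity of the total is inherited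
    from the spin side.\<close>
  moreover from this have "0 < (\<Sum>n\<in>N. v n)" using \<open>0 < E\<close> by (simp add: Z zero_less_mult_iff)
  ultimately show "measure_pmf.expectation (weighted_pmf S w) (\<lambda>(s, t). spin_prod s A * spin_prod t B) =
         measure_pmf.expectation (weighted_pmf N v) (\<lambda>n. kappa A (fst \<circ> n) * kappa B (snd \<circ> n))"
    using fin w v \<open>0 < E\<close> es[OF AB]
    by (simp add: expectation_weighted_pmf less_imp_le case_prod_unfold Z)
qed

lemma AT_weight_pos: "0 < AT_weight J\<^sub>\<sigma> J\<^sub>\<tau> J\<^sub>\<sigma>\<^sub>\<tau> \<B> x"
  by (auto simp: AT_weight_def split: prod.split intro!: prod_pos)

section \<open>Finiteness and the two boundary conditions\<close>

lemma finite_bonds_touching: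
  assumes "finite \<Lambda>"
  shows "finite (bonds_touching \<Lambda>)"
proof -
  \<comment> \<open>Contains \<open>\<Lambda>\<close> and all neighbours of its sites, hence both
    endpoints of each touching bond.\<close>
  define V where "V = (\<Union>(x, y)\<in>\<Lambda>. {x-1..x+1} \<times> {y-1..y+1})"
  have "finite V" using assms by (auto simp: V_def)
  have "endpoints b \<subseteq> V" if "b \<in> bonds_touching \<Lambda>" for b
  proof -
    obtain i j where ij: "endpoints b = {i, j}" "nearest_neighbours i j" by (rule endpoints_cases)
    then have "i \<in> \<Lambda> \<or> j \<in> \<Lambda>" using that by (auto simp: bonds_touching_def)
    then show ?thesis
      using ij unfolding V_def nearest_neighbours_def by (cases i; cases j) fastforce
  qed
  then have "endpoints ` bonds_touching \<Lambda> \<subseteq> Pow V" by auto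
  then have "finite (endpoints ` bonds_touching \<Lambda>)" using \<open>finite V\<close> finite_subset by blast
  then show ?thesis by (rule finite_imageD) (auto simp: inj_on_def endpoints_inject)
qed

lemma finite_bonds_inside: "finite \<Lambda> \<Longrightarrow> finite (bonds_inside \<Lambda>)"
proof (rule finite_subset[OF _ finite_bonds_touching])
  show "bonds_inside \<Lambda> \<subseteq> bonds_touching \<Lambda>"
    using endpoints by (fastforce simp: bonds_inside_def bonds_touching_def)
qed

lemma plus_bc_eq: "plus_bc \<Lambda> = PiE_dflt (bonds_touching \<Lambda>) (True, True) (\<lambda>_. UNIV)"
  by (auto simp: plus_bc_def PiE_dflt_def)

lemma free_bc_eq: "free_bc \<Lambda> = PiE_dflt (bonds_inside \<Lambda>) (False, False) (\<lambda>_. UNIV)"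
  by (auto simp: free_bc_def PiE_dflt_def)

lemma plus_spins_eq: "plus_spins \<Lambda> = spin_set 1 \<Lambda> \<times> spin_set 1 \<Lambda>"
  unfolding plus_spins_def spin_set_def PiE_dflt_def by fastforce

lemma free_spins_eq: "free_spins \<Lambda> = spin_set undefined \<Lambda> \<times> spin_set undefined \<Lambda>"
  unfolding free_spins_def spin_set_def PiE_dflt_def by (fastforce simp: PiE_def extensional_def)

text \<open>If a finite cluster \<open>C\<close> meeting \<open>\<Lambda>\<close> left it,
  \<open>no_holes\<close> for \<open>C - \<Lambda>\<close> would give a bond from a site of
  \<open>C\<close> to a site outside both \<open>C\<close> and \<open>\<Lambda>\<close>. That bond
  does not touch \<open>\<Lambda>\<close>, so it is open and puts the second site into
  \<open>C\<close>.\<close>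

lemma sum_compatible_plus:
  assumes bdd: "lattice_bounded \<Lambda>" and sc: "lattice_simply_connected \<Lambda>" and A: "A \<subseteq> \<Lambda>"
    and n: "n \<in> plus_bc \<Lambda>" and opn: "opn \<in> {fst \<circ> n, snd \<circ> n}"
  shows "(\<Sum>s | s \<in> spin_set 1 \<Lambda> \<and> compatible opn s (bonds_touching \<Lambda>). spin_prod s A) =
         kappa A opn * 2 ^ num_clusters opn \<Lambda>"
proof (rule sum_compatible_spins[OF finite_lattice_bounded[OF bdd] A])
  fix C assume C: "C \<in> clusters opn" "finite C" "C \<inter> \<Lambda> \<noteq> {}"
  show "C \<subseteq> \<Lambda>"
  proof (rule ccontr)
    assume "\<not> C \<subseteq> \<Lambda>"
    then obtain h k where hk: "h \<in> C - \<Lambda>" "k \<notin> C - \<Lambda>" "k \<notin> \<Lambda>" "nearest_neighbours h k"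
      using C no_holes[OF bdd sc, of "C - \<Lambda>"] C by blast
    then have b: "endpoints (Bond {h, k}) = {h, k}" by (intro Bond_inverse) blast
    then have "opn (Bond {h, k})" using hk n opn by (auto simp: plus_bc_def bonds_touching_def)
    then have "cluster opn h = cluster opn k" using b cluster_adjacent[of opn _ h k] by blast
    then have "k \<in> C" using clusters_cluster[OF C(1), of h] cluster_self[of k opn] hk by auto
    then show False using hk by blast
  qed
next
  fix b assume "opn b" "b \<notin> bonds_touching \<Lambda>"
  then show "endpoints b \<inter> \<Lambda> = {} \<and> (1::real) = 1" by (simp add: bonds_touching_def)
qed auto

text \<open>All open bonds lie inside \<open>\<Lambda>\<close>, so a path of open bonds starting in
  \<open>\<Lambda>\<close> never leaves it.\<close>

lemma sum_compatible_free:
  assumes fin: "finite \<Lambda>" and A: "A \<subseteq> \<Lambda>" and n: "n \<in> free_bc \<Lambda>" and opn: "opn \<in> {fst \<circ> n, snd \<circ> n}"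
  shows "(\<Sum>s | s \<in> spin_set d \<Lambda> \<and> compatible opn s (bonds_inside \<Lambda>). spin_prod s A) =
         kappa A opn * 2 ^ num_clusters opn \<Lambda>"
proof (rule sum_compatible_spins[OF fin A])
  have inside: "endpoints b \<subseteq> \<Lambda>" if "opn b" for b
    using n opn that by (force simp: free_bc_def bonds_inside_def)
  fix C assume C: "C \<in> clusters opn" "C \<inter> \<Lambda> \<noteq> {}"
  then obtain i where i: "i \<in> C" "i \<in> \<Lambda>" by blast
  have "j \<in> \<Lambda>" if "(i, j) \<in> (adjacency opn)\<^sup>*" for j
    using that i(2) by (induction rule: rtrancl_induct) (use inside in \<open>auto simp: adjacency_def\<close>)
  then show "C \<subseteq> \<Lambda>" using clusters_cluster[OF C(1) i(1)] by (auto simp: cluster_def)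
next
  show "d = 1 \<or> (\<forall>C\<in>clusters opn. finite C)"
    using finite_cluster_free_bc[OF fin n] opn by auto
next
  fix b assume "opn b" "b \<notin> bonds_inside \<Lambda>"
  then show "endpoints b \<inter> \<Lambda> = {} \<and> d = 1" using n opn by (auto simp: free_bc_def)
qed (auto simp: bonds_inside_def)

lemma grc_weight_nonneg:
  assumes "0 \<le> a\<^sub>0" "0 \<le> a\<^sub>\<sigma>" "0 \<le> a\<^sub>\<tau>" "0 \<le> a\<^sub>\<sigma>\<^sub>\<tau>"
  shows "0 \<le> grc_weight a\<^sub>0 a\<^sub>\<sigma> a\<^sub>\<tau> a\<^sub>\<sigma>\<^sub>\<tau> \<B> n"
  using assms by (simp add: grc_weight_def)

theorem proposition3p1:
  fixes J\<^sub>\<sigma> J\<^sub>\<tau> J\<^sub>\<sigma>\<^sub>\<tau> a\<^sub>0 a\<^sub>\<sigma> a\<^sub>\<tau> a\<^sub>\<sigma>\<^sub>\<tau> :: real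
  assumes "a\<^sub>0 = exp (-2 * (J\<^sub>\<sigma> + J\<^sub>\<tau>))"
    and "a\<^sub>\<sigma> = exp (-2 * J\<^sub>\<tau>) * (exp (-2 * J\<^sub>\<sigma>\<^sub>\<tau>) - exp (-2 * J\<^sub>\<sigma>))"
    and "a\<^sub>\<tau> = exp (-2 * J\<^sub>\<sigma>) * (exp (-2 * J\<^sub>\<sigma>\<^sub>\<tau>) - exp (-2 * J\<^sub>\<tau>))"
    and "a\<^sub>\<sigma>\<^sub>\<tau> = 1 - exp (-2 * (J\<^sub>\<sigma> + J\<^sub>\<sigma>\<^sub>\<tau>)) - exp (-2 * (J\<^sub>\<tau> + J\<^sub>\<sigma>\<^sub>\<tau>)) + exp (-2 * (J\<^sub>\<sigma> + J\<^sub>\<tau>))"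
  shows "(defines_prob_measure a\<^sub>0 a\<^sub>\<sigma> a\<^sub>\<tau> a\<^sub>\<sigma>\<^sub>\<tau> \<longleftrightarrow>
            J\<^sub>\<sigma> \<ge> J\<^sub>\<sigma>\<^sub>\<tau> \<and> J\<^sub>\<tau> \<ge> J\<^sub>\<sigma>\<^sub>\<tau> \<and> J\<^sub>\<sigma> \<ge> 0 \<and> J\<^sub>\<tau> \<ge> 0 \<and> tanh J\<^sub>\<sigma>\<^sub>\<tau> \<ge> - tanh J\<^sub>\<sigma> * tanh J\<^sub>\<tau>)
    \<and> (defines_prob_measure a\<^sub>0 a\<^sub>\<sigma> a\<^sub>\<tau> a\<^sub>\<sigma>\<^sub>\<tau> \<longrightarrow>
        (\<forall>\<Lambda> :: site set. lattice_bounded \<Lambda> \<and> lattice_simply_connected \<Lambda> \<longrightarrow>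
           (\<exists>C\<^sub>2 :: real. Z_plus J\<^sub>\<sigma> J\<^sub>\<tau> J\<^sub>\<sigma>\<^sub>\<tau> \<Lambda> =
              C\<^sub>2 * (\<Sum>n\<in>plus_bc \<Lambda>. grc_weight a\<^sub>0 a\<^sub>\<sigma> a\<^sub>\<tau> a\<^sub>\<sigma>\<^sub>\<tau> (bonds_touching \<Lambda>) n *
                     2 ^ num_clusters (fst \<circ> n) \<Lambda> * 2 ^ num_clusters (snd \<circ> n) \<Lambda>))
         \<and> (\<exists>C\<^sub>3 :: real. Z_free J\<^sub>\<sigma> J\<^sub>\<tau> J\<^sub>\<sigma>\<^sub>\<tau> \<Lambda> =
              C\<^sub>3 * (\<Sum>n\<in>free_bc \<Lambda>. grc_weight a\<^sub>0 a\<^sub>\<sigma> a\<^sub>\<tau> a\<^sub>\<sigma>\<^sub>\<tau> (bonds_inside \<Lambda>) n *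
                     2 ^ num_clusters (fst \<circ> n) \<Lambda> * 2 ^ num_clusters (snd \<circ> n) \<Lambda>))
         \<and> (\<forall>A B. A \<subseteq> \<Lambda> \<longrightarrow> B \<subseteq> \<Lambda> \<longrightarrow>
              measure_pmf.expectation (mu_plus J\<^sub>\<sigma> J\<^sub>\<tau> J\<^sub>\<sigma>\<^sub>\<tau> \<Lambda>)
                (\<lambda>(\<sigma>, \<tau>). spin_prod \<sigma> A * spin_prod \<tau> B) =
              measure_pmf.expectation (nu_plus a\<^sub>0 a\<^sub>\<sigma> a\<^sub>\<tau> a\<^sub>\<sigma>\<^sub>\<tau> \<Lambda> 2 2)
                (\<lambda>n. kappa A (fst \<circ> n) * kappa B (snd \<circ> n)) \<and>
              measure_pmf.expectation (mu_free J\<^sub>\<sigma> J\<^sub>\<tau> J\<^sub>\<sigma>\<^sub>\<tau> \<Lambda>)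
                (\<lambda>(\<sigma>, \<tau>). spin_prod \<sigma> A * spin_prod \<tau> B) =
              measure_pmf.expectation (nu_free a\<^sub>0 a\<^sub>\<sigma> a\<^sub>\<tau> a\<^sub>\<sigma>\<^sub>\<tau> \<Lambda> 2 2)
                (\<lambda>n. kappa A (fst \<circ> n) * kappa B (snd \<circ> n)))))"
proof (intro conjI impI allI; (elim conjE)?)
  show "defines_prob_measure a\<^sub>0 a\<^sub>\<sigma> a\<^sub>\<tau> a\<^sub>\<sigma>\<^sub>\<tau> \<longleftrightarrow>
      J\<^sub>\<sigma> \<ge> J\<^sub>\<sigma>\<^sub>\<tau> \<and> J\<^sub>\<tau> \<ge> J\<^sub>\<sigma>\<^sub>\<tau> \<and> J\<^sub>\<sigma> \<ge> 0 \<and> J\<^sub>\<tau> \<ge> 0 \<and> tanh J\<^sub>\<sigma>\<^sub>\<tau> \<ge> - tanh J\<^sub>\<sigma> * tanh J\<^sub>\<tau>"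
    using assms by (rule parameter_region)
next
  fix \<Lambda> :: "site set"
  assume prob: "defines_prob_measure a\<^sub>0 a\<^sub>\<sigma> a\<^sub>\<tau> a\<^sub>\<sigma>\<^sub>\<tau>"
    and bdd: "lattice_bounded \<Lambda>" and sc: "lattice_simply_connected \<Lambda>"
  let ?E = "exp (J\<^sub>\<sigma> + J\<^sub>\<tau> + J\<^sub>\<sigma>\<^sub>\<tau>)"
  let ?AT = "AT_weight J\<^sub>\<sigma> J\<^sub>\<tau> J\<^sub>\<sigma>\<^sub>\<tau>" and ?grc = "grc_weight a\<^sub>0 a\<^sub>\<sigma> a\<^sub>\<tau> a\<^sub>\<sigma>\<^sub>\<tau>"
  have fin: "finite \<Lambda>" using bdd by (rule finite_lattice_bounded)
  \<comment> \<open>Here the probability assumption enters, through the signs of the masses.\<close>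
  have nonneg: "0 \<le> ?grc \<B> n * cluster_weight 2 2 \<Lambda> n" for \<B> n
    using prob grc_weight_nonneg by (simp add: defines_prob_measure_iff cluster_weight_def)
  have ne: "spin_set d \<Lambda> \<noteq> {}" for d by (simp add: spin_set_def)
  \<comment> \<open>The coupling with \<open>d = 1\<close> and \<open>c = (True, True)\<close>; the
    free case below has \<open>d = undefined\<close> and \<open>c = (False, False)\<close>.\<close>
  have es_plus: "(\<Sum>(s, t)\<in>plus_spins \<Lambda>. ?AT (bonds_touching \<Lambda>) (s, t) * (spin_prod s A * spin_prod t B)) =
      ?E ^ card (bonds_touching \<Lambda>) * (\<Sum>n\<in>plus_bc \<Lambda>. ?grc (bonds_touching \<Lambda>) n * cluster_weight 2 2 \<Lambda> n *
        (kappa A (fst \<circ> n) * kappa B (snd \<circ> n)))" if "A \<subseteq> \<Lambda>" "B \<subseteq> \<Lambda>" for A B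
    unfolding plus_spins_eq plus_bc_eq
    by (rule edwards_sokal[OF assms finite_bonds_touching[OF fin] fin])
       (use that sum_compatible_plus[OF bdd sc] in \<open>auto simp: plus_bc_eq\<close>)
  have es_free: "(\<Sum>(s, t)\<in>free_spins \<Lambda>. ?AT (bonds_inside \<Lambda>) (s, t) * (spin_prod s A * spin_prod t B)) =
      ?E ^ card (bonds_inside \<Lambda>) * (\<Sum>n\<in>free_bc \<Lambda>. ?grc (bonds_inside \<Lambda>) n * cluster_weight 2 2 \<Lambda> n *
        (kappa A (fst \<circ> n) * kappa B (snd \<circ> n)))" if "A \<subseteq> \<Lambda>" "B \<subseteq> \<Lambda>" for A B
    unfolding free_spins_eq free_bc_eq
    by (rule edwards_sokal[OF assms finite_bonds_inside[OF fin] fin])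
       (use that sum_compatible_free[OF fin] in \<open>auto simp: free_bc_eq bonds_inside_def\<close>)
  have fins: "finite (plus_spins \<Lambda>)" "finite (free_spins \<Lambda>)" "finite (plus_bc \<Lambda>)" "finite (free_bc \<Lambda>)"
    using fin finite_spin_set finite_bonds_touching finite_bonds_inside
    by (auto simp: plus_spins_eq free_spins_eq plus_bc_eq free_bc_eq)
  have nes: "plus_spins \<Lambda> \<noteq> {}" "free_spins \<Lambda> \<noteq> {}"
    using ne by (auto simp: plus_spins_eq free_spins_eq)
  note plus = expectation_eq_of_edwards_sokal[OF fins(1,3) nes(1) AT_weight_pos nonneg _ es_plus]
  note free = expectation_eq_of_edwards_sokal[OF fins(2,4) nes(2) AT_weight_pos nonneg _ es_free]
  \<comment> \<open>The constant is the prefactor in \<open>Z_plus\<close> times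
    \<open>?E ^ card (bonds_touching \<Lambda>)\<close>; these are inverse to each other, so its
    value is 1.\<close>
  show "\<exists>C\<^sub>2. Z_plus J\<^sub>\<sigma> J\<^sub>\<tau> J\<^sub>\<sigma>\<^sub>\<tau> \<Lambda> = C\<^sub>2 * (\<Sum>n\<in>plus_bc \<Lambda>. ?grc (bonds_touching \<Lambda>) n *
           2 ^ num_clusters (fst \<circ> n) \<Lambda> * 2 ^ num_clusters (snd \<circ> n) \<Lambda>)"
    unfolding Z_plus_def Xi_plus_def
    by (subst plus(2)[of "{}" "{}"]) (auto simp: cluster_weight_def mult.assoc intro: exI[of _ "_ * _"])
  \<comment> \<open>Here \<open>?E ^ card (bonds_inside \<Lambda>)\<close> divided by the
    normalisation in \<open>Z_free\<close> serves as the constant.\<close>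
  show "\<exists>C\<^sub>3. Z_free J\<^sub>\<sigma> J\<^sub>\<tau> J\<^sub>\<sigma>\<^sub>\<tau> \<Lambda> = C\<^sub>3 * (\<Sum>n\<in>free_bc \<Lambda>. ?grc (bonds_inside \<Lambda>) n *
           2 ^ num_clusters (fst \<circ> n) \<Lambda> * 2 ^ num_clusters (snd \<circ> n) \<Lambda>)"
    unfolding Z_free_def Xi_free_def
    by (subst free(2)[of "{}" "{}"])
       (auto simp: cluster_weight_def mult.assoc times_divide_eq_left[symmetric] simp del: times_divide_eq_left)
  fix A B assume "A \<subseteq> \<Lambda>" "B \<subseteq> \<Lambda>"
  then show "measure_pmf.expectation (mu_plus J\<^sub>\<sigma> J\<^sub>\<tau> J\<^sub>\<sigma>\<^sub>\<tau> \<Lambda>) (\<lambda>(\<sigma>, \<tau>). spin_prod \<sigma> A * spin_prod \<tau> B) =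
      measure_pmf.expectation (nu_plus a\<^sub>0 a\<^sub>\<sigma> a\<^sub>\<tau> a\<^sub>\<sigma>\<^sub>\<tau> \<Lambda> 2 2) (\<lambda>n. kappa A (fst \<circ> n) * kappa B (snd \<circ> n))"
    unfolding mu_plus_def nu_plus_def by (intro plus(1)) auto
  show "measure_pmf.expectation (mu_free J\<^sub>\<sigma> J\<^sub>\<tau> J\<^sub>\<sigma>\<^sub>\<tau> \<Lambda>) (\<lambda>(\<sigma>, \<tau>). spin_prod \<sigma> A * spin_prod \<tau> B) =
      measure_pmf.expectation (nu_free a\<^sub>0 a\<^sub>\<sigma> a\<^sub>\<tau> a\<^sub>\<sigma>\<^sub>\<tau> \<Lambda> 2 2) (\<lambda>n. kappa A (fst \<circ> n) * kappa B (snd \<circ> n))"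
    unfolding mu_free_def nu_free_def using \<open>A \<subseteq> \<Lambda>\<close> \<open>B \<subseteq> \<Lambda>\<close> by (intro free(1)) auto
qed

end
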